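(* Let $\Bbbk$ be an algebraically closed field of characteristic different from $2$, and let $d\ge1$, $n\ge 2$ be integers. The irreducible components of $V(d,n)$ are the closures of the irreducible components of the strata $\mathcal S_{p,q}$ such that $(p,q)\in\Omega$ and $\sigma(p,q)\ge nd-\binom n2$.
   Context: Let $\Bbbk^d$ carry the standard form $\langle \mathbf v,\mathbf w\rangle=\sum_i v_iw_i$, and let $\mathrm{Mat}(d,n)$ be the affine space of $d\times n$ matrices over $\Bbbk$. Let $$V(d,n)=\{A\in \mathrm{Mat}(d,n): A^{\intercal}A\text{ is diagonal}\},$$ a (reduced) closed subvariety of $\mathrm{Mat}(d,n)$. A vector $\mathbf v$ is isotropic if $\langle\mathbf v,\mathbf v\rangle=0$ and anisotropic otherwise. For $A\in V(d,n)$, let $\mathrm{rk}_{\mathrm{ani}}(A)$ (resp. $\mathrm{rk}_{\mathrm{iso}}(A)$) be the dimension of the span of the anisotropic (resp. isotropic) columns of $A$. For integers $p,q\ge 0$ with $p+q\le n$ and $p+2q\le d$, let $$\mathcal S_{p,q}=\{A\in V(d,n): \mathrm{rk}_{\mathrm{ani}}(A)=p,\ \mathrm{rk}_{\mathrm{iso}}(A)=q\},$$ a locally closed subset. Let $$\sigma(p,q)=pd+qd+qn-\tfrac12p^2-2qp-\tfrac32q^2+\tfrac12p-\tfrac12q,$$ $$\Omega=\Big\{\big(\min(n-q,d-2q),\,q\big): 0\le q\le \min\big(n,\lfloor d/2\rfloor\big)\Big\}.$$ Closures are taken in $\mathrm{Mat}(d,n)$. *)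

theory Defs
  imports "HOL-Analysis.Analysis" "HOL-Computational_Algebra.Computational_Algebra"
begin

section \<open>Irreducible components of a topological space\<close>

definition irreducible_space :: "'a topology \<Rightarrow> bool" where
  "irreducible_space X \<longleftrightarrow> topspace X \<noteq> {} \<and>
     (\<forall>C D. closedin X C \<longrightarrow> closedin X D \<longrightarrow> topspace X = C \<union> D \<longrightarrow>
        C = topspace X \<or> D = topspace X)"

definition irreducible_components :: "'a topology \<Rightarrow> 'a set set" where
  "irreducible_components X =
     {C. C \<subseteq> topspace X \<and> irreducible_space (subtopology X C) \<and>
         (\<forall>D. D \<subseteq> topspace X \<longrightarrow> irreducible_space (subtopology X D) \<longrightarrow> C \<subseteq> D \<longrightarrow> D = C)}"


section \<open>The Zariski topology on the space of matrices\<close>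

text \<open>Regular functions on the affine space of \<open>d \<times> n\<close> matrices, i.e. polynomials in the
  matrix entries. A matrix with \<open>d\<close> rows and \<open>n\<close> columns has type \<open>'k ^ 'n ^ 'd\<close>.\<close>

inductive_set polynomial_functions :: "('k::comm_ring_1 ^ 'n ^ 'd \<Rightarrow> 'k) set" where
  const: "(\<lambda>_. c) \<in> polynomial_functions"
| coord: "(\<lambda>A. A $ i $ j) \<in> polynomial_functions"
| add: "f \<in> polynomial_functions \<Longrightarrow> g \<in> polynomial_functions \<Longrightarrow>
          (\<lambda>A. f A + g A) \<in> polynomial_functions"
| mult: "f \<in> polynomial_functions \<Longrightarrow> g \<in> polynomial_functions \<Longrightarrow>
          (\<lambda>A. f A * g A) \<in> polynomial_functions"

definition zero_locus :: "('k::comm_ring_1 ^ 'n ^ 'd \<Rightarrow> 'k) set \<Rightarrow> ('k ^ 'n ^ 'd) set" where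
  "zero_locus F = {A. \<forall>f\<in>F. f A = 0}"

definition zariski :: "('k::idom ^ 'n ^ 'd) topology" where
  "zariski = topology (\<lambda>U. \<exists>F. F \<subseteq> polynomial_functions \<and> - U = zero_locus F)"

text \<open>The definition of \<open>zariski\<close> via \<open>topology\<close> is meaningful only because the given sets form
  a topology:\<close>

lemma istopology_zariski:
  "istopology (\<lambda>U :: ('k::idom ^ 'n ^ 'd) set.
     \<exists>F. F \<subseteq> polynomial_functions \<and> - U = zero_locus F)"
  unfolding istopology_def
proof (intro conjI allI impI)
  fix S T :: "('k ^ 'n ^ 'd) set"
  assume "\<exists>F. F \<subseteq> polynomial_functions \<and> - S = zero_locus F"
    and "\<exists>F. F \<subseteq> polynomial_functions \<and> - T = zero_locus F"
  then obtain F G where FG: "F \<subseteq> polynomial_functions" "- S = zero_locus F"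
    "G \<subseteq> polynomial_functions" "- T = zero_locus G"
    by blast
  let ?H = "{\<lambda>A. f A * g A | f g. f \<in> F \<and> g \<in> G}"
  have "?H \<subseteq> polynomial_functions"
    using FG by (auto intro: polynomial_functions.mult)
  moreover have "zero_locus ?H = zero_locus F \<union> zero_locus G"
  proof
    show "zero_locus F \<union> zero_locus G \<subseteq> zero_locus ?H"
      by (auto simp: zero_locus_def)
    show "zero_locus ?H \<subseteq> zero_locus F \<union> zero_locus G"
    proof
      fix A assume A: "A \<in> zero_locus ?H"
      have "f A * g A = 0" if "f \<in> F" "g \<in> G" for f g
      proof -
        have "(\<lambda>A. f A * g A) \<in> ?H" using that by blast
        with A show ?thesis by (force simp: zero_locus_def)
      qed
      then show "A \<in> zero_locus F \<union> zero_locus G"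
        by (auto simp: zero_locus_def)
    qed
  qed
  ultimately show "\<exists>F. F \<subseteq> polynomial_functions \<and> - (S \<inter> T) = zero_locus F"
    using FG by (intro exI[of _ ?H]) auto
next
  fix K :: "('k ^ 'n ^ 'd) set set"
  assume "\<forall>U\<in>K. \<exists>F. F \<subseteq> polynomial_functions \<and> - U = zero_locus F"
  then obtain F where F: "\<And>U. U \<in> K \<Longrightarrow> F U \<subseteq> polynomial_functions \<and> - U = zero_locus (F U)"
    by metis
  have "- \<Union>K = (\<Inter>U\<in>K. zero_locus (F U))" using F by auto
  also have "\<dots> = zero_locus (\<Union>U\<in>K. F U)"
    by (auto simp: zero_locus_def)
  finally show "\<exists>F. F \<subseteq> polynomial_functions \<and> - \<Union>K = zero_locus F"
    using F by (intro exI[of _ "\<Union>U\<in>K. F U"]) auto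
qed

lemma topspace_zariski: "topspace (zariski :: ('k::idom ^ 'n ^ 'd) topology) = UNIV"
proof -
  have "- (UNIV :: ('k ^ 'n ^ 'd) set) = zero_locus {\<lambda>_. 1}"
    by (simp add: zero_locus_def)
  then have "openin zariski (UNIV :: ('k ^ 'n ^ 'd) set)"
    unfolding zariski_def topology_inverse'[OF istopology_zariski]
    using polynomial_functions.const by blast
  then show ?thesis
    using openin_subset by auto
qed

lemma closedin_zariski:
  "closedin zariski C \<longleftrightarrow> (\<exists>F. F \<subseteq> polynomial_functions \<and> C = zero_locus F)"
proof -
  have "closedin zariski C \<longleftrightarrow> openin zariski (- C)"
    by (simp add: closedin_def topspace_zariski Compl_eq_Diff_UNIV)
  also have "\<dots> \<longleftrightarrow> (\<exists>F. F \<subseteq> polynomial_functions \<and> C = zero_locus F)"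
    unfolding zariski_def topology_inverse'[OF istopology_zariski] by simp
  finally show ?thesis .
qed


section \<open>Matrices with pairwise orthogonal columns\<close>

definition isotropic :: "'k::semiring_1 ^ 'd \<Rightarrow> bool" where
  "isotropic v \<longleftrightarrow> scalar_product v v = 0"

definition V_var :: "('k::field ^ 'n ^ 'd) set" where
  "V_var = {A. \<forall>i j. i \<noteq> j \<longrightarrow> (transpose A ** A) $ i $ j = 0}"

text \<open>\<open>vec.dim S\<close> is the dimension of the linear span of \<open>S\<close>.\<close>

definition rk_ani :: "'k::field ^ 'n ^ 'd \<Rightarrow> nat" where
  "rk_ani A = vec.dim {v \<in> columns A. \<not> isotropic v}"

definition rk_iso :: "'k::field ^ 'n ^ 'd \<Rightarrow> nat" where
  "rk_iso A = vec.dim {v \<in> columns A. isotropic v}"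

definition stratum :: "nat \<Rightarrow> nat \<Rightarrow> ('k::field ^ 'n ^ 'd) set" where
  "stratum p q = {A \<in> V_var. rk_ani A = p \<and> rk_iso A = q}"

definition sigma_fun :: "nat \<Rightarrow> nat \<Rightarrow> nat \<Rightarrow> nat \<Rightarrow> real" where
  "sigma_fun d n p q =
     real p * real d + real q * real d + real q * real n - 1/2 * real p ^ 2
     - 2 * real q * real p - 3/2 * real q ^ 2 + 1/2 * real p - 1/2 * real q"

definition Omega :: "nat \<Rightarrow> nat \<Rightarrow> (nat \<times> nat) set" where
  "Omega d n = {(min (n - q) (d - 2 * q), q) | q. q \<le> min n (d div 2)}"

text \<open>The subtractions in \<open>Omega\<close> do not truncate, and all its elements index strata in the
  admissible range.\<close>

lemma Omega_admissible: "(p, q) \<in> Omega d n \<Longrightarrow> p + q \<le> n \<and> p + 2 * q \<le> d"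
  by (auto simp: Omega_def)

end

theory Submission
  imports Defs "HOL-Library.Function_Algebras"
begin

text \<open>
  Write \<open>a\<^sub>i\<close> for the columns of a matrix \<open>A\<close> in \<open>V\<close>, \<open>I\<close> for the set of indices of its anisotropic
  columns, and \<open>J\<close> for the indices of some isotropic columns that form a basis of the span of all
  isotropic columns. If \<open>A\<close> lies in the stratum \<open>(p, q)\<close>, then \<open>p = card I\<close>, \<open>q = card J\<close>, and
  \<open>s = n - p - q\<close> redundant isotropic columns \<open>a\<^sub>l = (\<Sum>j\<in>J. u\<^sub>l\<^sub>j a\<^sub>j)\<close> remain. The numerical condition of
  the theorem says that \<open>(p, q) = (n, 0)\<close>, or \<open>p + 2q = d\<close> and \<open>q \<le> s choose 2\<close> (lemma
  \<open>numerical_condition_iff\<close>). Here \<open>s choose 2\<close> is the number of pairs of redundant columns, and \<open>q\<close> is the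
  number of coefficients \<open>u\<^sub>l\<^sub>j\<close> of each of them; the proof compares these two numbers directly.

  Every matrix of any other stratum can be deformed along a line in \<open>V\<close> to matrices with more
  anisotropic columns. If \<open>p + 2q < d\<close> and \<open>p < n\<close>, some anisotropic vector is orthogonal to all columns,
  and its multiples can be added to an isotropic column. If \<open>p + 2q = d\<close>, choose isotropic vectors \<open>w\<^sub>j\<close>
  dual to the \<open>a\<^sub>j\<close>; moving \<open>a\<^sub>j\<close> in the direction \<open>g\<^sub>j w\<^sub>j\<close>, and the redundant columns accordingly, keeps the
  columns orthogonal exactly when \<open>(\<Sum>j\<in>J. g\<^sub>j u\<^sub>l\<^sub>j u\<^sub>m\<^sub>j) = 0\<close> for all pairs \<open>l \<noteq> m\<close> of redundant columns. These are
  \<open>s choose 2\<close> linear equations for \<open>q\<close> unknowns, so they have a nonzero solution if \<open>q > s choose 2\<close>.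
  By induction on the number of isotropic columns, \<open>V\<close> is the closure of the union of the strata that
  satisfy the numerical condition (lemma \<open>V_var_subset_closure\<close>).

  If on the contrary \<open>q \<le> s choose 2\<close>, then for a general point of the stratum these equations have
  only the solution \<open>g = 0\<close>. This rigidity is not merely infinitesimal: for \<open>B\<close> in \<open>V\<close> near such a
  point \<open>A\<close>, the vector of the values \<open>\<langle>b\<^sub>j, b\<^sub>j\<rangle>\<close> for the columns \<open>b\<^sub>j\<close> of \<open>B\<close> with \<open>j\<close> in \<open>J\<close> is in the kernel of
  a square matrix \<open>M(B)\<close> that depends rationally on \<open>B\<close> and is invertible near \<open>A\<close>, so these columns are
  isotropic (lemmas \<open>isotropy_is_forced\<close> and \<open>V_var_near_generic_point\<close>). Hence a general point is
  interior to its stratum relative to \<open>V\<close>; for \<open>(p, q) = (n, 0)\<close> every point is, since being anisotropic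
  is an open condition. General points are dense in the stratum, because the redundant columns
  can be moved freely within the span of the isotropic columns.

  The theorem is then a fact about topological spaces (theorem
  \<open>irreducible_components_eq_closures_of_strata\<close>): if finitely many strata have a dense union in \<open>V\<close>,
  each has a dense set of points interior to it relative to \<open>V\<close>, and each is a finite union of
  irreducible sets, then the components of \<open>V\<close> are the closures of the components of the strata. The
  last of these hypotheses is a consequence of Hilbert's basis theorem.
\<close>

section \<open>Irreducible sets and unions of closures of strata\<close>

text \<open>Irreducibility of a subset, tested with closed sets of the ambient space instead of the subspace;
the same closed sets then serve for all subsets at once.\<close>
definition irreducible_in :: "'a topology \<Rightarrow> 'a set \<Rightarrow> bool" where
  "irreducible_in X T \<longleftrightarrow> T \<subseteq> topspace X \<and> T \<noteq> {} \<and>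
     (\<forall>C D. closedin X C \<longrightarrow> closedin X D \<longrightarrow> T \<subseteq> C \<union> D \<longrightarrow> T \<subseteq> C \<or> T \<subseteq> D)"

lemma irreducible_inD:
  assumes "irreducible_in X T" "closedin X C" "closedin X D" "T \<subseteq> C \<union> D"
  shows "T \<subseteq> C \<or> T \<subseteq> D"
  using assms unfolding irreducible_in_def by blast

lemma irreducible_space_subtopology_iff:
  assumes "T \<subseteq> topspace X"
  shows "irreducible_space (subtopology X T) \<longleftrightarrow> irreducible_in X T"
proof -
  have top: "topspace (subtopology X T) = T" using assms by auto
  show ?thesis
  proof
    assume L: "irreducible_space (subtopology X T)"
    have "T \<subseteq> C \<or> T \<subseteq> D" if "closedin X C" "closedin X D" "T \<subseteq> C \<union> D" for C D
    proof -
      have "closedin (subtopology X T) (T \<inter> C)" "closedin (subtopology X T) (T \<inter> D)"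
        using that by (auto simp: closedin_subtopology)
      moreover have "T = (T \<inter> C) \<union> (T \<inter> D)" using that by auto
      ultimately have "T \<inter> C = T \<or> T \<inter> D = T"
        using L unfolding irreducible_space_def top by blast
      then show ?thesis by blast
    qed
    then show "irreducible_in X T"
      using L assms unfolding irreducible_in_def irreducible_space_def top by blast
  next
    assume R: "irreducible_in X T"
    have "C = T \<or> D = T" if C: "closedin (subtopology X T) C" and D: "closedin (subtopology X T) D"
        and un: "T = C \<union> D" for C D
    proof -
      obtain C' D' where "closedin X C'" "C = C' \<inter> T" "closedin X D'" "D = D' \<inter> T"
        using C D by (auto simp: closedin_subtopology)
      then show ?thesis using irreducible_inD[OF R, of C' D'] un by blast
    qed
    then show "irreducible_space (subtopology X T)"
      using R unfolding irreducible_in_def irreducible_space_def top by blast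
  qed
qed

text \<open>A subspace of a subspace is a subspace of the ambient space, so components of a subspace are maximal
irreducible subsets in the sense of the ambient space.\<close>
lemma irreducible_components_subtopology:
  assumes "V \<subseteq> topspace X"
  shows "irreducible_components (subtopology X V) =
    {C. C \<subseteq> V \<and> irreducible_in X C \<and> (\<forall>D. D \<subseteq> V \<longrightarrow> irreducible_in X D \<longrightarrow> C \<subseteq> D \<longrightarrow> D = C)}"
proof -
  have top: "topspace (subtopology X V) = V" using assms by auto
  have eq: "irreducible_space (subtopology (subtopology X V) C) = irreducible_in X C" if "C \<subseteq> V" for C
    using that assms
    by (simp add: subtopology_subtopology Int_absorb1 irreducible_space_subtopology_iff)
  show ?thesis unfolding irreducible_components_def top by (simp add: eq cong: conj_cong imp_cong)
qed

lemma irreducible_in_dense: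
  assumes irr: "irreducible_in X T" and "T \<subseteq> T'" "T' \<subseteq> X closure_of T"
  shows "irreducible_in X T'"
  unfolding irreducible_in_def
proof (intro conjI allI impI)
  show "T' \<subseteq> topspace X" using assms(3) closure_of_subset_topspace[of X T] by blast
  show "T' \<noteq> {}" using assms unfolding irreducible_in_def by blast
  fix C D assume C: "closedin X C" and D: "closedin X D" and "T' \<subseteq> C \<union> D"
  then have "T \<subseteq> C \<or> T \<subseteq> D" using irreducible_inD[OF irr C D] assms(2) by blast
  then show "T' \<subseteq> C \<or> T' \<subseteq> D"
    using C D assms(3) closure_of_minimal[of T C X] closure_of_minimal[of T D X] by blast
qed

lemma irreducible_in_closure_of:
  assumes "irreducible_in X T" shows "irreducible_in X (X closure_of T)"
proof -
  have "T \<subseteq> X closure_of T"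
    using assms unfolding irreducible_in_def by (intro closure_of_subset) blast
  then show ?thesis using irreducible_in_dense[OF assms] by blast
qed

lemma irreducible_in_subset_Union:
  assumes irr: "irreducible_in X T" and "finite \<F>" and "\<And>C. C \<in> \<F> \<Longrightarrow> closedin X C" and "T \<subseteq> \<Union>\<F>"
  shows "\<exists>C\<in>\<F>. T \<subseteq> C"
  using assms(2,3,4)
proof (induction \<F>)
  case empty
  then show ?case using irr unfolding irreducible_in_def by auto
next
  case (insert C \<F>)
  have "closedin X (\<Union>\<F>)" using insert by (intro closedin_Union) auto
  then have "T \<subseteq> C \<or> T \<subseteq> \<Union>\<F>"
    using irreducible_inD[OF irr, of C "\<Union>\<F>"] insert by auto
  then show ?case using insert by auto
qed

text \<open>An irreducible set is covered by the complement of \<open>N\<close> and the closure of its part in \<open>N\<close>; the former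
misses a point.\<close>
lemma irreducible_in_open_dense:
  assumes irr: "irreducible_in X T" and N: "openin X N" and "T \<inter> N \<noteq> {}"
  shows "T \<subseteq> X closure_of (T \<inter> N)"
proof -
  have T: "T \<subseteq> topspace X" using irr unfolding irreducible_in_def by blast
  have "T \<subseteq> (topspace X - N) \<union> X closure_of (T \<inter> N)"
    using T closure_of_subset[of "T \<inter> N" X] by blast
  then have "T \<subseteq> topspace X - N \<or> T \<subseteq> X closure_of (T \<inter> N)"
    using irreducible_inD[OF irr _ closedin_closure_of] N by (meson openin_closedin_eq)
  then show ?thesis using assms(3) by blast
qed

lemma irreducible_in_open:
  assumes irr: "irreducible_in X T" and N: "openin X N" and "T \<inter> N \<noteq> {}"
  shows "irreducible_in X (T \<inter> N)"
  unfolding irreducible_in_def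
proof (intro conjI allI impI)
  show "T \<inter> N \<subseteq> topspace X" "T \<inter> N \<noteq> {}"
    using assms unfolding irreducible_in_def by blast+
  fix C D assume C: "closedin X C" and D: "closedin X D" and "T \<inter> N \<subseteq> C \<union> D"
  then have "X closure_of (T \<inter> N) \<subseteq> C \<union> D" by (meson closedin_Un closure_of_minimal)
  then have "T \<subseteq> C \<or> T \<subseteq> D"
    using irreducible_inD[OF irr C D] irreducible_in_open_dense[OF assms] by blast
  then show "T \<inter> N \<subseteq> C \<or> T \<inter> N \<subseteq> D" by blast
qed

text \<open>Let \<open>C\<close> be a component of a stratum \<open>S\<close>. Since \<open>S\<close> has a finite irreducible cover, \<open>C\<close> contains a
nonempty open part of \<open>S\<close>, hence a point that has a neighbourhood \<open>N\<close> with \<open>V \<inter> N \<subseteq> S\<close>. An irreducible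
subset \<open>D\<close> of \<open>V\<close> that contains \<open>C\<close> has the dense part \<open>D \<inter> N\<close>, which lies in \<open>S\<close> and therefore in \<open>C\<close>. So
the closure of \<open>C\<close> is maximal. Conversely, a component of \<open>V\<close> is contained in one of the finitely many
closures of irreducible pieces of the strata, hence in the closure of a component of a stratum.\<close>
theorem irreducible_components_eq_closures_of_strata:
  assumes V: "closedin X V"
    and fin: "finite \<S>"
    and sub: "\<And>S. S \<in> \<S> \<Longrightarrow> S \<subseteq> V"
    and cover: "V \<subseteq> X closure_of (\<Union>\<S>)"
    and inner: "\<And>S. S \<in> \<S> \<Longrightarrow> S \<subseteq> X closure_of {A \<in> S. \<exists>N. openin X N \<and> A \<in> N \<and> V \<inter> N \<subseteq> S}"
    and finirr: "\<And>S. S \<in> \<S> \<Longrightarrow> \<exists>\<E>. finite \<E> \<and> (\<forall>E\<in>\<E>. irreducible_in X E) \<and> S = \<Union>\<E>"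
  shows "irreducible_components (subtopology X V) =
    {X closure_of C | C S. S \<in> \<S> \<and> C \<in> irreducible_components (subtopology X S)}"
proof -
  have VX: "V \<subseteq> topspace X" using V closedin_subset by blast
  define maxirr where "maxirr S C \<longleftrightarrow> C \<subseteq> S \<and> irreducible_in X C \<and>
      (\<forall>D. D \<subseteq> S \<longrightarrow> irreducible_in X D \<longrightarrow> C \<subseteq> D \<longrightarrow> D = C)" for S C
  have comps: "irreducible_components (subtopology X S) = {C. maxirr S C}" if "S \<subseteq> V" for S
    unfolding maxirr_def using irreducible_components_subtopology[of S X] that VX by blast
  have SX: "S \<subseteq> topspace X" if "S \<in> \<S>" for S using sub[OF that] VX by blast
  have clsub: "X closure_of C \<subseteq> V" if "C \<subseteq> V" for C using that V by (rule closure_of_minimal)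
  \<comment> \<open>\<open>D\<close> is irreducible, being squeezed between \<open>T\<close> and its closure, so maximality of \<open>C\<close> applies to it.\<close>
  have absorb: "D = C" if "maxirr S C" "irreducible_in X T" "T \<subseteq> S" "D \<subseteq> S" "T \<subseteq> D" "D \<subseteq> X closure_of T" "C \<subseteq> D" for S C T D
    using that irreducible_in_dense[of X T D] unfolding maxirr_def by blast
  \<comment> \<open>A finite cover by irreducible sets yields, for each maximal irreducible subset \<open>C\<close> of a stratum,
      an open set that meets the stratum only inside \<open>C\<close>; it contains an interior point.\<close>
  have meets: "\<exists>A\<in>C. \<exists>N. openin X N \<and> A \<in> N \<and> V \<inter> N \<subseteq> S" if S: "S \<in> \<S>" and C: "maxirr S C" for S C
  proof -
    obtain \<E> where \<E>: "finite \<E>" "\<forall>E\<in>\<E>. irreducible_in X E" "S = \<Union>\<E>" using finirr[OF S] by blast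
    define B where "B = \<Union>{X closure_of E | E. E \<in> \<E> \<and> \<not> C \<subseteq> X closure_of E}"
    have Bc: "closedin X B" unfolding B_def using \<E>(1) by (intro closedin_Union) auto
    have Cirr: "irreducible_in X C" and CS: "C \<subseteq> S" using C unfolding maxirr_def by blast+
    have "\<not> C \<subseteq> B"
    proof
      assume "C \<subseteq> B"
      then have "\<exists>D\<in>{X closure_of E | E. E \<in> \<E> \<and> \<not> C \<subseteq> X closure_of E}. C \<subseteq> D"
        using \<E>(1) unfolding B_def by (intro irreducible_in_subset_Union[OF Cirr]) auto
      then show False by blast
    qed
    then obtain A0 where A0: "A0 \<in> C" "A0 \<notin> B" by blast
    have SN: "S - B \<subseteq> C"
    proof
      fix x assume x: "x \<in> S - B"
      then obtain E where E: "E \<in> \<E>" "x \<in> E" using \<E>(3) by blast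
      have ES: "E \<subseteq> S" using E \<E>(3) by blast
      have "E \<subseteq> X closure_of E" using ES SX[OF S] by (intro closure_of_subset) blast
      then have "C \<subseteq> X closure_of E" using x E unfolding B_def by blast
      then have "S \<inter> X closure_of E = C"
        using absorb[OF C, of E "S \<inter> X closure_of E"] E \<E> ES CS \<open>E \<subseteq> X closure_of E\<close> by blast
      then show "x \<in> C" using E ES \<open>E \<subseteq> X closure_of E\<close> by blast
    qed
    have "openin X (topspace X - B)" using Bc by blast
    moreover have "A0 \<in> topspace X - B" using A0 CS SX[OF S] by blast
    moreover have "A0 \<in> X closure_of {A \<in> S. \<exists>N. openin X N \<and> A \<in> N \<and> V \<inter> N \<subseteq> S}"
      using inner[OF S] A0 CS by blast
    ultimately obtain A where "A \<in> S" "\<exists>N. openin X N \<and> A \<in> N \<and> V \<inter> N \<subseteq> S" "A \<in> topspace X - B"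
      unfolding in_closure_of by blast
    then show ?thesis using SN by blast
  qed
  have cl_max: "maxirr V (X closure_of C)" if S: "S \<in> \<S>" and C: "maxirr S C" for S C
  proof -
    have Cirr: "irreducible_in X C" and CS: "C \<subseteq> S" using C unfolding maxirr_def by blast+
    obtain A N where A: "A \<in> C" and N: "openin X N" "A \<in> N" "V \<inter> N \<subseteq> S" using meets[OF S C] by blast
    have CV: "C \<subseteq> V" using CS sub[OF S] by blast
    have CX: "C \<subseteq> X closure_of C" using CV VX by (intro closure_of_subset) blast
    have "D = X closure_of C" if D: "D \<subseteq> V" "irreducible_in X D" "X closure_of C \<subseteq> D" for D
    proof -
      let ?T = "D \<inter> N"
      have ne: "?T \<noteq> {}" using A N D CX by blast
      have T: "irreducible_in X ?T" using irreducible_in_open[OF D(2) N(1) ne] .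
      have dT: "D \<subseteq> X closure_of ?T" using irreducible_in_open_dense[OF D(2) N(1) ne] .
      have TS: "?T \<subseteq> S" using D N by blast
      have "?T \<subseteq> X closure_of ?T" using TS SX[OF S] by (intro closure_of_subset) blast
      then have "S \<inter> X closure_of ?T = C"
        using absorb[OF C T TS, of "S \<inter> X closure_of ?T"] TS CS CX D(3) dT by blast
      then have "?T \<subseteq> C" using TS \<open>?T \<subseteq> X closure_of ?T\<close> by blast
      then have "D \<subseteq> X closure_of C" using dT closure_of_mono[of ?T C X] by blast
      then show ?thesis using D(3) by blast
    qed
    then show ?thesis
      using irreducible_in_closure_of[OF Cirr] clsub[OF CV] unfolding maxirr_def by blast
  qed
  \<comment> \<open>Zorn's lemma; a union of a chain of irreducible sets is irreducible.\<close>
  have ex_max: "\<exists>C. maxirr S C \<and> E \<subseteq> C" if S: "S \<in> \<S>" and E: "irreducible_in X E" "E \<subseteq> S" for S E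
  proof -
    let ?P = "{D. D \<subseteq> S \<and> irreducible_in X D \<and> E \<subseteq> D}"
    have "\<exists>M\<in>?P. \<forall>D\<in>?P. M \<subseteq> D \<longrightarrow> D = M"
    proof (rule subset_Zorn_nonempty)
      show "?P \<noteq> {}" using E by blast
      fix \<C> assume ne: "\<C> \<noteq> {}" and ch: "subset.chain ?P \<C>"
      have sub: "\<C> \<subseteq> ?P" and lin: "\<And>a b. a \<in> \<C> \<Longrightarrow> b \<in> \<C> \<Longrightarrow> a \<subseteq> b \<or> b \<subseteq> a"
        using ch unfolding subset_chain_def by auto
      have "\<Union>\<C> \<subseteq> A \<or> \<Union>\<C> \<subseteq> B" if "closedin X A" "closedin X B" "\<Union>\<C> \<subseteq> A \<union> B" for A B
      proof (rule ccontr)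
        assume "\<not> ?thesis"
        then obtain a b where ab: "a \<in> \<C>" "\<not> a \<subseteq> A" "b \<in> \<C>" "\<not> b \<subseteq> B" by blast
        have irr: "irreducible_in X a" "irreducible_in X b" "a \<subseteq> A \<union> B" "b \<subseteq> A \<union> B"
          using ab sub that(3) by blast+
        then show False
          using lin[OF ab(1,3)] ab irreducible_inD[OF irr(1) that(1,2)] irreducible_inD[OF irr(2) that(1,2)] by blast
      qed
      moreover have "\<Union>\<C> \<subseteq> topspace X" "\<Union>\<C> \<noteq> {}" "\<Union>\<C> \<subseteq> S" "E \<subseteq> \<Union>\<C>"
      proof -
        show "\<Union>\<C> \<subseteq> S" "E \<subseteq> \<Union>\<C>" using sub ne by blast+
        show "\<Union>\<C> \<subseteq> topspace X" using \<open>\<Union>\<C> \<subseteq> S\<close> SX[OF S] by (rule subset_trans)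
        have "E \<noteq> {}" using E(1) unfolding irreducible_in_def by blast
        then show "\<Union>\<C> \<noteq> {}" using \<open>E \<subseteq> \<Union>\<C>\<close> by blast
      qed
      ultimately show "\<Union>\<C> \<in> ?P" unfolding irreducible_in_def mem_Collect_eq by (intro conjI allI impI)
    qed
    then obtain M where M: "M \<in> ?P" "\<forall>D\<in>?P. M \<subseteq> D \<longrightarrow> D = M" by (rule bexE)
    have EM: "E \<subseteq> M" using M(1) by simp
    have "maxirr S M"
      unfolding maxirr_def using M order_trans[OF EM] by simp
    then show ?thesis using EM by (intro exI conjI)
  qed
  show ?thesis
    unfolding comps[OF subset_refl]
  proof (intro equalityI subsetI)
    fix Z assume "Z \<in> {C. maxirr V C}"
    then have Z: "maxirr V Z" by simp
    then have Zirr: "irreducible_in X Z" and ZV: "Z \<subseteq> V" unfolding maxirr_def by blast+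
    have "\<exists>\<E>. \<forall>S\<in>\<S>. finite (\<E> S) \<and> (\<forall>E\<in>\<E> S. irreducible_in X E) \<and> S = \<Union>(\<E> S)"
      using finirr by metis
    then obtain \<E> where \<E>: "\<forall>S\<in>\<S>. finite (\<E> S) \<and> (\<forall>E\<in>\<E> S. irreducible_in X E) \<and> S = \<Union>(\<E> S)"
      by (rule exE)
    have \<E>1: "finite (\<E> S)" and \<E>2: "E \<in> \<E> S \<Longrightarrow> irreducible_in X E" and \<E>3: "S = \<Union>(\<E> S)"
      if "S \<in> \<S>" for S E
      using bspec[OF \<E> that] by (elim conjE, assumption | blast)+
    let ?F = "(closure_of) X ` (\<Union>S\<in>\<S>. \<E> S)"
    have "finite ?F" using fin \<E>1 by blast
    moreover have "\<Union>\<S> \<subseteq> \<Union>?F"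
    proof
      fix x assume "x \<in> \<Union>\<S>"
      then obtain S where S0: "S \<in> \<S>" "x \<in> S" by (rule UnionE)
      have "x \<in> \<Union>(\<E> S)" using S0(2) \<E>3[OF S0(1)] by (rule back_subst[of "\<lambda>S. x \<in> S"])
      then obtain E where S: "S \<in> \<S>" "E \<in> \<E> S" "x \<in> E" using S0(1) by blast
      have "E \<subseteq> X closure_of E"
        using \<E>2[OF S(1,2)] unfolding irreducible_in_def by (intro closure_of_subset) blast
      then show "x \<in> \<Union>?F" using S by blast
    qed
    moreover have "closedin X (\<Union>?F)"
      using \<open>finite ?F\<close> by (intro closedin_Union) auto
    ultimately have "Z \<subseteq> \<Union>?F" using ZV cover closure_of_minimal[of "\<Union>\<S>" "\<Union>?F" X] by blast
    then have "\<exists>C\<in>?F. Z \<subseteq> C"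
    proof (rule irreducible_in_subset_Union[OF Zirr \<open>finite ?F\<close>, rotated])
      show "closedin X D" if "D \<in> ?F" for D using that by (elim imageE) simp
    qed
    then obtain S E where S: "S \<in> \<S>" and E: "E \<in> \<E> S" "Z \<subseteq> X closure_of E" by blast
    have "E \<subseteq> \<Union>(\<E> S)" using E(1) by blast
    then have "E \<subseteq> S" using \<E>3[OF S] by simp
    then obtain C where C: "maxirr S C" "E \<subseteq> C" using ex_max[OF S] \<E>2[OF S E(1)] by blast
    have "Z \<subseteq> X closure_of C" using E(2) closure_of_mono[OF C(2), of X] by blast
    then have "X closure_of C = Z"
      using Z cl_max[OF S C(1)] unfolding maxirr_def by blast
    moreover have "C \<in> irreducible_components (subtopology X S)"
      using C(1) unfolding comps[OF sub[OF S]] by simp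
    ultimately show "Z \<in> {X closure_of C | C S. S \<in> \<S> \<and> C \<in> irreducible_components (subtopology X S)}"
      using S unfolding mem_Collect_eq by (intro exI[of _ C] exI[of _ S]) simp
  next
    fix Z assume "Z \<in> {X closure_of C | C S. S \<in> \<S> \<and> C \<in> irreducible_components (subtopology X S)}"
    then obtain C S where CS: "Z = X closure_of C" "S \<in> \<S>" "C \<in> irreducible_components (subtopology X S)"
      by auto
    then have "maxirr S C" unfolding comps[OF sub[OF CS(2)]] by simp
    then show "Z \<in> {C. maxirr V C}" using cl_max[OF CS(2)] CS(1) by simp
  qed
qed

section \<open>Noetherian rings of functions\<close>

text \<open>Subrings, ideals and the Noetherian property are relative to a carrier set inside a type. Adjoining the
matrix entries one after the other then stays within the single type of all functions on matrices,
which is a commutative ring under the pointwise operations.\<close>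
definition is_subring :: "'a::comm_ring_1 set \<Rightarrow> bool" where
  "is_subring R \<longleftrightarrow> 1 \<in> R \<and> (\<forall>x\<in>R. - x \<in> R) \<and> (\<forall>x\<in>R. \<forall>y\<in>R. x + y \<in> R \<and> x * y \<in> R)"

definition is_ideal :: "'a::comm_ring_1 set \<Rightarrow> 'a set \<Rightarrow> bool" where
  "is_ideal R I \<longleftrightarrow> I \<subseteq> R \<and> 0 \<in> I \<and> (\<forall>x\<in>I. \<forall>y\<in>I. x + y \<in> I) \<and> (\<forall>r\<in>R. \<forall>x\<in>I. r * x \<in> I)"

inductive_set ideal_gen :: "'a::comm_ring_1 set \<Rightarrow> 'a set \<Rightarrow> 'a set" for R B where
  zero: "0 \<in> ideal_gen R B"
| step: "r \<in> R \<Longrightarrow> b \<in> B \<Longrightarrow> x \<in> ideal_gen R B \<Longrightarrow> r * b + x \<in> ideal_gen R B"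

definition noetherian :: "'a::comm_ring_1 set \<Rightarrow> bool" where
  "noetherian R \<longleftrightarrow> (\<forall>I. is_ideal R I \<longrightarrow> (\<exists>B. finite B \<and> B \<subseteq> I \<and> I \<subseteq> ideal_gen R B))"

lemma noetherianE:
  assumes "noetherian R" "is_ideal R I"
  obtains B where "finite B" "B \<subseteq> I" "I \<subseteq> ideal_gen R B"
proof -
  have "\<exists>B. finite B \<and> B \<subseteq> I \<and> I \<subseteq> ideal_gen R B"
    using assms unfolding noetherian_def by simp
  then show thesis using that by (elim exE conjE)
qed

lemma is_subring_zero: "is_subring R \<Longrightarrow> 0 \<in> R"
  unfolding is_subring_def by (metis add.right_inverse)

lemma is_subring_sum: "is_subring R \<Longrightarrow> (\<And>i. i \<in> A \<Longrightarrow> f i \<in> R) \<Longrightarrow> sum f A \<in> R"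
  by (induction A rule: infinite_finite_induct) (auto simp: is_subring_zero is_subring_def)

lemma ideal_gen_add: "x \<in> ideal_gen R B \<Longrightarrow> y \<in> ideal_gen R B \<Longrightarrow> x + y \<in> ideal_gen R B"
  by (induction rule: ideal_gen.induct) (auto simp: add.assoc intro: ideal_gen.step)

lemma ideal_gen_mult:
  assumes "is_subring R" "r \<in> R" "x \<in> ideal_gen R B"
  shows "r * x \<in> ideal_gen R B"
  using assms(3)
proof induction
  case (step s b x)
  have "(r * s) * b + r * x \<in> ideal_gen R B"
    using step assms(1,2) by (intro ideal_gen.step) (auto simp: is_subring_def)
  then show ?case by (simp add: distrib_left mult.assoc)
qed (simp add: ideal_gen.zero)

lemma ideal_gen_base: "is_subring R \<Longrightarrow> b \<in> B \<Longrightarrow> b \<in> ideal_gen R B"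
  using ideal_gen.step[of 1 R b B 0] ideal_gen.zero[of R B] by (simp add: is_subring_def)

lemma ideal_gen_mono: "B \<subseteq> C \<Longrightarrow> ideal_gen R B \<subseteq> ideal_gen R C"
proof
  fix x assume "x \<in> ideal_gen R B" and "B \<subseteq> C"
  then show "x \<in> ideal_gen R C" by (induction rule: ideal_gen.induct) (auto intro: ideal_gen.intros)
qed

lemma ideal_gen_subset: "is_ideal R I \<Longrightarrow> B \<subseteq> I \<Longrightarrow> ideal_gen R B \<subseteq> I"
proof
  fix x assume "x \<in> ideal_gen R B" and "is_ideal R I" "B \<subseteq> I"
  then show "x \<in> I" by (induction rule: ideal_gen.induct) (auto simp: is_ideal_def)
qed

lemma is_ideal_ideal_gen: "is_subring R \<Longrightarrow> B \<subseteq> R \<Longrightarrow> is_ideal R (ideal_gen R B)"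
proof -
  assume R: "is_subring R" and B: "B \<subseteq> R"
  have "is_ideal R R" using R is_subring_zero[OF R] unfolding is_ideal_def is_subring_def by blast
  then show ?thesis
    using ideal_gen_subset[of R R B] B ideal_gen_add[of _ R B] ideal_gen_mult[OF R, of _ _ B] ideal_gen.zero[of R B]
    unfolding is_ideal_def[of R "ideal_gen R B"] by blast
qed

lemma ideal_gen_range:
  assumes "x \<in> ideal_gen R (range a)"
  shows "\<exists>n. x \<in> ideal_gen R (a ` {..<n::nat})"
  using assms
proof induction
  case zero
  then show ?case using ideal_gen.zero by blast
next
  case (step r b x)
  then obtain n i where n: "x \<in> ideal_gen R (a ` {..<n})" and i: "b = a i" by blast
  have "x \<in> ideal_gen R (a ` {..<max n (Suc i)})"
    using n ideal_gen_mono[of "a ` {..<n}" "a ` {..<max n (Suc i)}" R] image_mono[of "{..<n}" "{..<max n (Suc i)}" a]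
    by auto
  then have "r * b + x \<in> ideal_gen R (a ` {..<max n (Suc i)})"
    using step i by (intro ideal_gen.step) auto
  then show ?case by blast
qed

text \<open>The ideal generated by all members of the sequence is already generated by finitely many of them.\<close>
lemma noetherian_stationary:
  assumes R: "is_subring R" "noetherian R" and a: "range a \<subseteq> R"
  shows "\<exists>n. a n \<in> ideal_gen R (a ` {..<n::nat})"
proof -
  let ?A = "ideal_gen R (range a)"
  obtain B where B: "finite B" "B \<subseteq> ?A" "?A \<subseteq> ideal_gen R B"
    using noetherianE[OF R(2) is_ideal_ideal_gen[OF R(1) a]] .
  have "\<forall>b\<in>B. \<exists>n. b \<in> ideal_gen R (a ` {..<n})" using B(2) ideal_gen_range by blast
  then obtain f where f: "\<And>b. b \<in> B \<Longrightarrow> b \<in> ideal_gen R (a ` {..<f b})" by metis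
  define N where "N = (\<Sum>b\<in>B. f b)"
  have "B \<subseteq> ideal_gen R (a ` {..<N})"
  proof
    fix b assume b: "b \<in> B"
    have "f b \<le> N" unfolding N_def using b B(1) by (simp add: member_le_sum)
    then show "b \<in> ideal_gen R (a ` {..<N})"
      using f[OF b] ideal_gen_mono[of "a ` {..<f b}" "a ` {..<N}" R] image_mono[of "{..<f b}" "{..<N}" a] by auto
  qed
  then have "ideal_gen R B \<subseteq> ideal_gen R (a ` {..<N})"
    using a by (intro ideal_gen_subset is_ideal_ideal_gen R(1)) auto
  then show ?thesis using B(3) ideal_gen_base[OF R(1), of "a N" "range a"] by blast
qed

definition polys_over :: "'a::comm_ring_1 set \<Rightarrow> 'a poly set" where
  "polys_over R = {P. \<forall>i. coeff P i \<in> R}"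

lemma is_subring_polys_over:
  assumes R: "is_subring R" shows "is_subring (polys_over R)"
proof -
  have "coeff 1 i \<in> R" for i
    using R is_subring_zero[OF R] by (simp add: coeff_1 is_subring_def)
  moreover have "coeff (P * Q) i \<in> R" if "\<And>i. coeff P i \<in> R" "\<And>i. coeff Q i \<in> R" for P Q i
    unfolding coeff_mult using that R by (intro is_subring_sum[OF R]) (auto simp: is_subring_def)
  ultimately show ?thesis
    using R by (auto simp: is_subring_def polys_over_def)
qed

text \<open>Hilbert's basis theorem, with the classical proof. If an ideal \<open>I\<close> is not finitely generated, choose
\<open>g\<^sub>n\<close> of least degree among the elements of \<open>I\<close> outside the ideal generated by the earlier choices. Some
leading coefficient is a combination of the earlier ones, and subtracting the corresponding
combination of earlier \<open>g\<^sub>i\<close>, shifted to the same degree, contradicts minimality.\<close>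
lemma noetherian_polys_over:
  assumes R: "is_subring R" "noetherian R"
  shows "noetherian (polys_over R)"
proof (rule ccontr)
  let ?P = "polys_over R"
  have sP: "is_subring ?P" using is_subring_polys_over[OF R(1)] .
  assume "\<not> noetherian ?P"
  then obtain I where I: "is_ideal ?P I" and nf0: "\<not> (\<exists>B. finite B \<and> B \<subseteq> I \<and> I \<subseteq> ideal_gen ?P B)"
    unfolding noetherian_def by auto
  have nf: "\<exists>x. x \<in> I - ideal_gen ?P B" if "finite B" "B \<subseteq> I" for B
    using nf0 that by (auto simp: subset_iff)
  define c where "c B = (SOME x. x \<in> I - ideal_gen ?P B \<and> (\<forall>y \<in> I - ideal_gen ?P B. degree x \<le> degree y))" for B
  have c: "c B \<in> I - ideal_gen ?P B \<and> (\<forall>y \<in> I - ideal_gen ?P B. degree (c B) \<le> degree y)"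
    if B: "finite B" "B \<subseteq> I" for B
    unfolding c_def
  proof (rule someI_ex)
    obtain x where "x \<in> I - ideal_gen ?P B" using nf[OF B] by blast
    then show "\<exists>x. x \<in> I - ideal_gen ?P B \<and> (\<forall>y \<in> I - ideal_gen ?P B. degree x \<le> degree y)"
      using ex_has_least_nat[of "\<lambda>x. x \<in> I - ideal_gen ?P B" x degree] by blast
  qed
  define Bs where "Bs = rec_nat {} (\<lambda>_ B. insert (c B) B)"
  define g where "g n = c (Bs n)" for n
  have Bs: "Bs n = g ` {..<n}" for n
    by (induction n) (auto simp: Bs_def g_def lessThan_Suc)
  have BsI: "finite (Bs n) \<and> Bs n \<subseteq> I" for n
  proof (induction n)
    case (Suc n)
    then show ?case using c[of "Bs n"] by (auto simp: Bs_def)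
  qed (simp add: Bs_def)
  have g: "g n \<in> I" "g n \<notin> ideal_gen ?P (g ` {..<n})"
      "\<And>y. y \<in> I \<Longrightarrow> y \<notin> ideal_gen ?P (g ` {..<n}) \<Longrightarrow> degree (g n) \<le> degree y" for n
  proof -
    have "g n \<in> I - ideal_gen ?P (Bs n) \<and> (\<forall>y \<in> I - ideal_gen ?P (Bs n). degree (g n) \<le> degree y)"
      unfolding g_def using c BsI by blast
    then show "g n \<in> I" "g n \<notin> ideal_gen ?P (g ` {..<n})"
        "\<And>y. y \<in> I \<Longrightarrow> y \<notin> ideal_gen ?P (g ` {..<n}) \<Longrightarrow> degree (g n) \<le> degree y"
      unfolding Bs by auto
  qed
  have gP: "g n \<in> ?P" for n using g(1) I unfolding is_ideal_def by blast
  define a where "a n = lead_coeff (g n)" for n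
  have "range a \<subseteq> R" using gP unfolding a_def polys_over_def by auto
  then obtain N where N: "a N \<in> ideal_gen R (a ` {..<N})"
    using noetherian_stationary[OF R] by blast
  define d where "d = degree (g N)"
  have deg_le: "degree (g i) \<le> d" if "i < N" for i
  proof -
    have "g ` {..<i} \<subseteq> g ` {..<N}" using that by auto
    then show ?thesis
      unfolding d_def using g(2)[of N] ideal_gen_mono[of "g ` {..<i}" "g ` {..<N}" ?P] by (intro g(3) g(1)) blast
  qed
  \<comment> \<open>A combination of leading coefficients is the coefficient at \<open>d\<close> of a combination of the \<open>g\<^sub>i\<close>.\<close>
  have "\<exists>Q \<in> ideal_gen ?P (g ` {..<N}). coeff Q d = x \<and> degree Q \<le> d" if "x \<in> ideal_gen R (a ` {..<N})" for x
    using that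
  proof induction
    case zero
    then show ?case by (intro bexI[of _ 0] ideal_gen.zero) auto
  next
    case (step r b x)
    then obtain i Q where i: "i < N" "b = a i"
      and Q: "Q \<in> ideal_gen ?P (g ` {..<N})" "coeff Q d = x" "degree Q \<le> d" by auto
    let ?M = "monom r (d - degree (g i)) * g i"
    have "monom r (d - degree (g i)) \<in> ?P"
      using step(1) is_subring_zero[OF R(1)] by (auto simp: polys_over_def)
    then have "?M + Q \<in> ideal_gen ?P (g ` {..<N})"
      using Q(1) i by (intro ideal_gen.step) auto
    moreover have "coeff (?M + Q) d = r * b + x"
      using Q(2) i deg_le[OF i(1)] by (simp add: coeff_monom_mult a_def)
    moreover have "degree (?M + Q) \<le> d"
    proof (rule degree_add_le[OF _ Q(3)])
      have "degree ?M \<le> degree (monom r (d - degree (g i))) + degree (g i)" by (rule degree_mult_le)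
      also have "\<dots> \<le> (d - degree (g i)) + degree (g i)" by (simp add: degree_monom_le)
      finally show "degree ?M \<le> d" using deg_le[OF i(1)] by simp
    qed
    ultimately show ?case by blast
  qed
  then obtain Q where Q: "Q \<in> ideal_gen ?P (g ` {..<N})" "coeff Q d = a N" "degree Q \<le> d"
    using N by blast
  have QI: "Q \<in> I" using Q(1) ideal_gen_subset[OF I, of "g ` {..<N}"] g(1) by blast
  have "- 1 \<in> ?P" using sP unfolding is_subring_def by blast
  then have "- 1 * Q \<in> I" using QI I unfolding is_ideal_def by blast
  then have "g N + - 1 * Q \<in> I" using g(1)[of N] I unfolding is_ideal_def by blast
  then have PI: "g N - Q \<in> I" by simp
  have PN: "g N - Q \<notin> ideal_gen ?P (g ` {..<N})"
    using ideal_gen_add[OF _ Q(1), of "g N - Q"] g(2)[of N] by auto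
  have "degree (g N - Q) \<le> d" using Q(3) by (intro degree_diff_le) (auto simp: d_def)
  moreover have "d \<le> degree (g N - Q)" using g(3)[OF PI PN] by (simp add: d_def)
  moreover have "coeff (g N - Q) d = 0" using Q(2) by (simp add: a_def d_def)
  ultimately have "g N - Q = 0" by (metis leading_coeff_0_iff order_antisym)
  then show False using PN ideal_gen.zero by metis
qed

lemma noetherian_image:
  assumes S: "noetherian S"
    and add: "\<And>x y. \<phi> (x + y) = \<phi> x + \<phi> y" and mult: "\<And>x y. \<phi> (x * y) = \<phi> x * \<phi> y"
    and sub: "is_subring S"
  shows "noetherian (\<phi> ` S)"
  unfolding noetherian_def
proof (intro allI impI)
  fix I assume I: "is_ideal (\<phi> ` S) I"
  have z: "\<phi> 0 = 0" using add[of 0 0] by simp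
  have "is_ideal S {x \<in> S. \<phi> x \<in> I}"
    unfolding is_ideal_def
  proof (intro conjI ballI)
    show "0 \<in> {x \<in> S. \<phi> x \<in> I}" using I is_subring_zero[OF sub] z by (simp add: is_ideal_def)
    fix x y assume "x \<in> {x \<in> S. \<phi> x \<in> I}" "y \<in> {x \<in> S. \<phi> x \<in> I}"
    then show "x + y \<in> {x \<in> S. \<phi> x \<in> I}" using I sub by (simp add: is_ideal_def is_subring_def add)
  next
    fix x y assume "x \<in> S" "y \<in> {x \<in> S. \<phi> x \<in> I}"
    then show "x * y \<in> {x \<in> S. \<phi> x \<in> I}" using I sub by (simp add: is_ideal_def is_subring_def mult)
  qed blast
  then obtain B where B: "finite B" "B \<subseteq> {x \<in> S. \<phi> x \<in> I}" "{x \<in> S. \<phi> x \<in> I} \<subseteq> ideal_gen S B"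
    by (rule noetherianE[OF S])
  have im: "\<phi> x \<in> ideal_gen (\<phi> ` S) (\<phi> ` B)" if "x \<in> ideal_gen S B" for x
    using that by induction (auto simp: z add mult intro: ideal_gen.intros)
  have "I \<subseteq> ideal_gen (\<phi> ` S) (\<phi> ` B)"
  proof
    fix y assume y: "y \<in> I"
    then obtain x where "x \<in> S" "y = \<phi> x" using I unfolding is_ideal_def by blast
    then show "y \<in> ideal_gen (\<phi> ` S) (\<phi> ` B)" using B(3) im y by blast
  qed
  then show "\<exists>B. finite B \<and> B \<subseteq> I \<and> I \<subseteq> ideal_gen (\<phi> ` S) B"
    using B by (intro exI[of _ "\<phi> ` B"]) auto
qed

lemma noetherian_field: "noetherian (UNIV :: 'k::field set)"
  unfolding noetherian_def
proof (intro allI impI)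
  fix I :: "'k set" assume I: "is_ideal UNIV I"
  show "\<exists>B. finite B \<and> B \<subseteq> I \<and> I \<subseteq> ideal_gen UNIV B"
  proof (cases "I \<subseteq> {0}")
    case True
    then show ?thesis by (intro exI[of _ "{}"]) (auto intro: ideal_gen.zero)
  next
    case False
    then obtain x where x: "x \<in> I" "x \<noteq> 0" by blast
    have "y \<in> ideal_gen UNIV {x}" for y
      using ideal_gen.step[of "y / x" UNIV x "{x}" 0] ideal_gen.zero x by auto
    then show ?thesis using x by (intro exI[of _ "{x}"]) auto
  qed
qed

lemma poly_in_polynomial_functions:
  assumes "\<And>i. coeff P i \<in> polynomial_functions" and h: "h \<in> polynomial_functions"
  shows "poly P h \<in> polynomial_functions"
  using assms(1)
proof (induction P)
  case 0
  then show ?case using polynomial_functions.const[of 0] by (simp add: zero_fun_def)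
next
  case (pCons a P)
  have a: "a \<in> polynomial_functions" and P: "coeff P i \<in> polynomial_functions" for i
    using pCons.prems[of 0] pCons.prems[of "Suc i"] by auto
  have "poly P h \<in> polynomial_functions" by (rule pCons.IH[OF P])
  then have "(\<lambda>A. a A + (h A * poly P h A)) \<in> polynomial_functions"
    using a h by (intro polynomial_functions.add polynomial_functions.mult)
  then show ?case by (simp add: plus_fun_def times_fun_def)
qed

text \<open>Adjoining a function \<open>h\<close> to a ring \<open>R\<close> of functions gives the image of the polynomials over \<open>R\<close> under
evaluation at \<open>h\<close>. Starting with the constants, adjoin the finitely many matrix entries.\<close>
theorem noetherian_polynomial_functions:
  "noetherian (polynomial_functions :: ('k::field ^ 'n ^ 'd \<Rightarrow> 'k) set)"
proof -
  have ex: "\<exists>R :: ('k ^ 'n ^ 'd \<Rightarrow> 'k) set. is_subring R \<and> noetherian R \<and> range (\<lambda>c _. c) \<subseteq> R \<and> C \<subseteq> R \<and>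
        R \<subseteq> polynomial_functions"
    if "finite C" "C \<subseteq> polynomial_functions" for C
    using that
  proof induction
    case empty
    let ?R = "range (\<lambda>(c::'k) (_::'k ^ 'n ^ 'd). c)"
    have "is_subring ?R"
      by (auto simp: is_subring_def plus_fun_def times_fun_def one_fun_def fun_Compl_def)
    moreover have "noetherian ?R"
      by (rule noetherian_image[OF noetherian_field]) (auto simp: is_subring_def plus_fun_def times_fun_def)
    ultimately show ?case by (intro exI[of _ ?R]) (auto intro: polynomial_functions.const)
  next
    case (insert h C)
    then obtain R :: "('k ^ 'n ^ 'd \<Rightarrow> 'k) set" where R: "is_subring R" "noetherian R"
      "range (\<lambda>c _. c) \<subseteq> R" "C \<subseteq> R" "R \<subseteq> polynomial_functions" by auto
    let ?S = "(\<lambda>P. poly P h) ` polys_over R"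
    have sP: "is_subring (polys_over R)" using is_subring_polys_over[OF R(1)] .
    have "is_subring ?S"
    proof -
      have "1 \<in> ?S" using sP by (intro image_eqI[of _ _ 1]) (auto simp: is_subring_def)
      moreover have "- poly P h \<in> ?S" if "P \<in> polys_over R" for P
        using sP that by (intro image_eqI[of _ _ "- P"]) (auto simp: is_subring_def)
      moreover have "poly P h + poly Q h \<in> ?S" if "P \<in> polys_over R" "Q \<in> polys_over R" for P Q
        using sP that by (intro image_eqI[of _ _ "P + Q"]) (auto simp: is_subring_def)
      moreover have "poly P h * poly Q h \<in> ?S" if "P \<in> polys_over R" "Q \<in> polys_over R" for P Q
        using sP that by (intro image_eqI[of _ _ "P * Q"]) (auto simp: is_subring_def)
      ultimately show ?thesis by (auto simp: is_subring_def)
    qed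
    moreover have "noetherian ?S"
      by (intro noetherian_image noetherian_polys_over R sP) auto
    moreover have "R \<subseteq> ?S"
    proof
      fix r assume "r \<in> R"
      then have "[:r:] \<in> polys_over R"
        using is_subring_zero[OF R(1)] by (auto simp: polys_over_def coeff_pCons split: nat.split)
      then show "r \<in> ?S" by (intro image_eqI[of _ _ "[:r:]"]) auto
    qed
    moreover have "h \<in> ?S"
    proof -
      have "[:0, 1:] \<in> polys_over R"
        using is_subring_zero[OF R(1)] R(1) by (auto simp: polys_over_def coeff_pCons is_subring_def split: nat.split)
      then show ?thesis by (intro image_eqI[of _ _ "[:0, 1:]"]) auto
    qed
    moreover have "?S \<subseteq> polynomial_functions"
    proof
      fix f assume "f \<in> ?S"
      then obtain P where P: "P \<in> polys_over R" "f = poly P h" by blast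
      have "coeff P i \<in> polynomial_functions" for i using P(1) R(5) by (auto simp: polys_over_def)
      moreover have "h \<in> polynomial_functions" using insert.prems by simp
      ultimately show "f \<in> polynomial_functions" unfolding P(2) by (rule poly_in_polynomial_functions)
    qed
    ultimately show ?case using R(3,4) by (intro exI[of _ ?S]) auto
  qed
  let ?C = "\<Union>i. \<Union>j. {\<lambda>A :: 'k ^ 'n ^ 'd. A $ i $ j}"
  have "finite ?C" "?C \<subseteq> polynomial_functions" by (auto intro: polynomial_functions.coord)
  from ex[OF this] obtain R :: "('k ^ 'n ^ 'd \<Rightarrow> 'k) set" where R: "is_subring R" "noetherian R"
      "range (\<lambda>c _. c) \<subseteq> R" "?C \<subseteq> R" "R \<subseteq> polynomial_functions" by (elim exE conjE)
  have "f \<in> R" if "f \<in> polynomial_functions" for f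
    using that
  proof induction
    case (add f g)
    then have "f + g \<in> R" using R(1) unfolding is_subring_def by blast
    then show ?case by (simp add: plus_fun_def)
  next
    case (mult f g)
    then have "f * g \<in> R" using R(1) unfolding is_subring_def by blast
    then show ?case by (simp add: times_fun_def)
  qed (use R(3,4) in blast)+
  then show ?thesis using R(2,5) by (metis subsetI subset_antisym)
qed

text \<open>The functions that vanish on some member of a descending chain of closed sets form an ideal. Its
finitely many generators all vanish on a common member of the chain, and from there on the chain is
constant.\<close>
lemma wf_zariski_closed:
  "wf {(Z', Z). closedin zariski Z' \<and> closedin zariski Z \<and> Z' \<subset> (Z :: ('k::field ^ 'n ^ 'd) set)}"
  unfolding wf_iff_no_infinite_down_chain
proof
  assume "\<exists>Z. \<forall>i. (Z (Suc i), Z i) \<in> {(Z', Z). closedin zariski Z' \<and> closedin zariski Z \<and> Z' \<subset> (Z :: ('k ^ 'n ^ 'd) set)}"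
  then obtain Z :: "nat \<Rightarrow> ('k ^ 'n ^ 'd) set"
    where "\<forall>i. (Z (Suc i), Z i) \<in> {(Z', Z). closedin zariski Z' \<and> closedin zariski Z \<and> Z' \<subset> Z}"
    by (elim exE)
  then have Z: "closedin zariski (Z i)" "Z (Suc i) \<subset> Z i" for i by simp_all
  have dec: "Z j \<subseteq> Z i" if "i \<le> j" for i j
    by (rule lift_Suc_antimono_le[OF _ that]) (use Z(2) in blast)
  let ?I = "{f \<in> polynomial_functions. \<exists>n. \<forall>A\<in>Z n. f A = 0}"
  have "is_ideal polynomial_functions ?I"
    unfolding is_ideal_def
  proof (intro conjI ballI)
    show "?I \<subseteq> polynomial_functions" by blast
    show "0 \<in> ?I" using polynomial_functions.const[of 0] by (auto simp: zero_fun_def)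
    fix f g :: "'k ^ 'n ^ 'd \<Rightarrow> 'k" assume "f \<in> ?I" "g \<in> ?I"
    then obtain n m where "f \<in> polynomial_functions" "g \<in> polynomial_functions"
      "\<forall>A\<in>Z n. f A = 0" "\<forall>A\<in>Z m. g A = 0" by blast
    then have fg: "f \<in> polynomial_functions" "g \<in> polynomial_functions"
      "\<And>A. A \<in> Z n \<Longrightarrow> f A = 0" "\<And>A. A \<in> Z m \<Longrightarrow> g A = 0" by blast+
    have "f A + g A = 0" if "A \<in> Z (max n m)" for A
    proof -
      have "A \<in> Z n" "A \<in> Z m" using dec[of n "max n m"] dec[of m "max n m"] that by auto
      then show ?thesis using fg(3,4) by simp
    qed
    then show "f + g \<in> ?I"
      using polynomial_functions.add[OF fg(1,2)] by (auto simp: plus_fun_def)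
  next
    fix f g :: "'k ^ 'n ^ 'd \<Rightarrow> 'k" assume "f \<in> polynomial_functions" "g \<in> ?I"
    then show "f * g \<in> ?I"
      using polynomial_functions.mult[of f g] by (auto simp: times_fun_def)
  qed
  then obtain B where B: "finite B" "B \<subseteq> ?I" "?I \<subseteq> ideal_gen polynomial_functions B"
    by (rule noetherianE[OF noetherian_polynomial_functions])
  have "\<forall>f\<in>B. \<exists>n. \<forall>A\<in>Z n. f A = 0" using B(2) by blast
  then obtain m where m: "\<And>f. f \<in> B \<Longrightarrow> \<forall>A\<in>Z (m f). f A = 0" by metis
  define N where "N = (\<Sum>f\<in>B. m f)"
  have BN: "f A = 0" if "f \<in> B" "A \<in> Z N" for f A
  proof -
    have "m f \<le> N" unfolding N_def using that(1) B(1) by (simp add: member_le_sum)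
    then have "A \<in> Z (m f)" using dec[of "m f" N] that(2) by blast
    then show ?thesis using m[OF that(1)] by blast
  qed
  have gen: "f A = 0" if "f \<in> ideal_gen polynomial_functions B" "A \<in> Z N" for f A
    using that(1) by induction (simp_all add: BN that(2))
  obtain F where F: "F \<subseteq> polynomial_functions" "Z (Suc N) = zero_locus F"
    using Z(1) closedin_zariski by blast
  have "F \<subseteq> ?I" using F by (auto simp: zero_locus_def intro!: exI[of _ "Suc N"])
  then have "Z N \<subseteq> zero_locus F" using B(3) gen by (auto simp: zero_locus_def)
  then show False using F(2) Z(2)[of N] by blast
qed

section \<open>Frames of isotropic columns\<close>

notation scalar_product (infixl "\<cdot>" 70)

lemma sp_commute: "(v :: 'k::comm_semiring_1 ^ 'd) \<cdot> w = w \<cdot> v"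
  by (simp add: scalar_product_def mult.commute)

lemma sp_add_left: "((u :: 'k::comm_ring_1 ^ 'd) + v) \<cdot> w = u \<cdot> w + v \<cdot> w"
  by (simp add: scalar_product_def distrib_right sum.distrib)

lemma sp_add_right: "w \<cdot> ((u :: 'k::comm_ring_1 ^ 'd) + v) = w \<cdot> u + w \<cdot> v"
  by (simp add: scalar_product_def distrib_left sum.distrib)

lemma sp_diff_left: "((u :: 'k::comm_ring_1 ^ 'd) - v) \<cdot> w = u \<cdot> w - v \<cdot> w"
  by (simp add: scalar_product_def left_diff_distrib sum_subtractf)

lemma sp_diff_right: "w \<cdot> ((u :: 'k::comm_ring_1 ^ 'd) - v) = w \<cdot> u - w \<cdot> v"
  by (simp add: scalar_product_def right_diff_distrib sum_subtractf)

lemma sp_scale_left: "(c *s (u :: 'k::comm_ring_1 ^ 'd)) \<cdot> w = c * (u \<cdot> w)"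
  by (simp add: scalar_product_def sum_distrib_left mult.assoc)

lemma sp_scale_right: "w \<cdot> (c *s (u :: 'k::comm_ring_1 ^ 'd)) = c * (w \<cdot> u)"
  by (simp add: scalar_product_def sum_distrib_left mult.left_commute)

lemma sp_zero_left [simp]: "(0 :: 'k::comm_ring_1 ^ 'd) \<cdot> w = 0"
  by (simp add: scalar_product_def)

lemma sp_zero_right [simp]: "w \<cdot> (0 :: 'k::comm_ring_1 ^ 'd) = 0"
  by (simp add: scalar_product_def)

lemma sp_sum_left: "sum f S \<cdot> (w :: 'k::comm_ring_1 ^ 'd) = (\<Sum>i\<in>S. f i \<cdot> w)"
  by (induction S rule: infinite_finite_induct) (simp_all add: sp_add_left)

lemma sp_sum_right: "(w :: 'k::comm_ring_1 ^ 'd) \<cdot> sum f S = (\<Sum>i\<in>S. w \<cdot> f i)"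
  by (induction S rule: infinite_finite_induct) (simp_all add: sp_add_right)

lemmas sp_simps = sp_add_left sp_add_right sp_diff_left sp_diff_right sp_scale_left sp_scale_right
  sp_sum_left sp_sum_right

lemma sp_axis: "axis i 1 \<cdot> (w :: 'k::comm_ring_1 ^ 'd) = w $ i"
  by (simp add: scalar_product_def axis_def if_distrib if_distribR cong: if_cong)

lemma sp_nondegenerate:
  assumes "(u :: 'k::comm_ring_1 ^ 'd) \<noteq> 0" shows "\<exists>v. v \<cdot> u \<noteq> 0"
proof -
  obtain i where "u $ i \<noteq> 0" using assms by (auto simp: vec_eq_iff)
  then show ?thesis using sp_axis[of i u] by metis
qed

lemma sp_span_eq_0:
  assumes "\<And>s. s \<in> S \<Longrightarrow> g \<cdot> s = 0" and "x \<in> vec.span S"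
  shows "g \<cdot> (x :: 'k::field ^ 'd) = 0"
proof -
  have "vec.subspace {x. g \<cdot> x = 0}"
    by (rule vec.subspaceI) (auto simp: sp_simps)
  then have "vec.span S \<subseteq> {x. g \<cdot> x = 0}"
    using assms(1) by (intro vec.span_minimal) auto
  then show ?thesis using assms(2) by blast
qed

text \<open>Every linear functional is a scalar product with some vector, here with a row of the matrix of a linear
map that kills \<open>S\<close> but not \<open>v\<close>.\<close>
lemma ex_sp_separating:
  assumes v: "(v :: 'k::field ^ 'd) \<notin> vec.span S"
  shows "\<exists>g. (\<forall>s\<in>S. g \<cdot> s = 0) \<and> g \<cdot> v = 1"
proof -
  obtain B where B: "B \<subseteq> S" "vec.independent B" "S \<subseteq> vec.span B"
    using vec.maximal_independent_subset by blast
  have "vec.span B \<subseteq> vec.span S" using B(1) by (rule vec.span_mono)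
  then have vB: "v \<notin> vec.span B" using v by blast
  then have ind: "vec.independent (insert v B)" using B(2) by (simp add: vec.independent_insert)
  have vnB: "v \<notin> B" using vB vec.span_base by blast
  obtain T where T: "Vector_Spaces.linear (*s) (*s) T"
      "\<forall>x\<in>insert v B. T x = (if x = v then axis undefined 1 else (0 :: 'k ^ 'd))"
    using vec.linear_independent_extend[OF ind, of "\<lambda>x. if x = v then axis undefined 1 else 0"] by blast
  define g where "g = row undefined (matrix T)"
  have g: "g \<cdot> x = T x $ undefined" for x
    unfolding matrix_works[OF T(1), of x, symmetric]
    by (simp add: g_def row_def scalar_product_def matrix_vector_mult_def)
  have "g \<cdot> s = 0" if "s \<in> B" for s using T(2) that vnB by (auto simp: g)
  then have "g \<cdot> s = 0" if "s \<in> S" for s using sp_span_eq_0[of B g s] B(3) that by blast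
  moreover have "g \<cdot> v = 1" using T(2) by (simp add: g axis_def)
  ultimately show ?thesis by blast
qed

lemma ex_nonzero_orthogonal:
  assumes S: "vec.dim S < CARD('d)"
  shows "\<exists>g :: 'k::field ^ 'd. g \<noteq> 0 \<and> (\<forall>s\<in>S. g \<cdot> s = 0)"
proof -
  have "vec.span S \<noteq> UNIV"
    using S vec_dim_card[where 'a = 'k and 'n = 'd] vec.dim_span[of S] by force
  then obtain v where "v \<notin> vec.span S" by blast
  then obtain g where "\<forall>s\<in>S. g \<cdot> s = 0" "g \<cdot> v = 1" using ex_sp_separating by blast
  then show ?thesis by (intro exI[of _ g]) auto
qed

lemma ex_dual_family:
  assumes inj: "inj_on b H" and ind: "vec.independent (b ` H)"
  shows "\<exists>v :: 'i \<Rightarrow> 'k::field ^ 'd. \<forall>j\<in>H. \<forall>h\<in>H. v j \<cdot> b h = (if h = j then 1 else 0)"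
proof -
  have "\<exists>g. \<forall>h\<in>H. g \<cdot> b h = (if h = j then 1 else 0)" if j: "j \<in> H" for j
  proof -
    have eq: "b ` H - {b j} = b ` (H - {j})" using inj j by (auto simp: inj_on_def)
    have "b j \<notin> vec.span (b ` H - {b j})"
      using ind j unfolding vec.dependent_def by blast
    then obtain g where "\<forall>s\<in>b ` (H - {j}). g \<cdot> s = 0" "g \<cdot> b j = 1"
      unfolding eq using ex_sp_separating by blast
    then show ?thesis by (intro exI[of _ g]) auto
  qed
  then show ?thesis by metis
qed

text \<open>Linear independence of a family is always established below by writing down a dual family.\<close>
lemma independent_if_dual_family:
  assumes dual: "\<And>j h. j \<in> H \<Longrightarrow> h \<in> H \<Longrightarrow> v j \<cdot> b h = (if h = j then 1 else (0::'k::field))"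
  shows "inj_on b H" "vec.independent (b ` H)"
proof -
  show inj: "inj_on b H"
  proof (rule inj_onI)
    fix j h assume jh: "j \<in> H" "h \<in> H" "b j = b h"
    then have "v j \<cdot> b j = v j \<cdot> b h" by simp
    then show "j = h" using dual[OF jh(1) jh(1)] dual[OF jh(1,2)] by (simp split: if_splits)
  qed
  show "vec.independent (b ` H)"
    unfolding vec.dependent_def
  proof
    assume "\<exists>a\<in>b ` H. a \<in> vec.span (b ` H - {a})"
    then obtain j where j: "j \<in> H" "b j \<in> vec.span (b ` H - {b j})" by blast
    have "v j \<cdot> s = 0" if "s \<in> b ` H - {b j}" for s
      using that dual[OF j(1)] by auto
    then have "v j \<cdot> b j = 0" using sp_span_eq_0 j(2) by blast
    then show False using dual[OF j(1) j(1)] by simp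
  qed
qed

lemma V_var_iff: "A \<in> V_var \<longleftrightarrow> (\<forall>i j. i \<noteq> j \<longrightarrow> column i A \<cdot> column j A = 0)"
  by (simp add: V_var_def matrix_matrix_mult_def transpose_def column_def scalar_product_def)

text \<open>The index set of the anisotropic columns. Working with indices rather than with the set of columns
keeps equal columns apart.\<close>
definition ani_cols :: "'k::field ^ 'n ^ 'd \<Rightarrow> 'n set" where
  "ani_cols A = {i. column i A \<cdot> column i A \<noteq> 0}"

text \<open>Pairwise orthogonal anisotropic vectors are independent, and rescaling them gives a dual family.\<close>
lemma rk_ani_eq_card:
  assumes A: "A \<in> V_var" shows "rk_ani A = card (ani_cols A)"
proof -
  have eq: "{v \<in> columns A. \<not> isotropic v} = (\<lambda>i. column i A) ` ani_cols A"
    by (auto simp: columns_def isotropic_def ani_cols_def)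
  have "(inverse (column j A \<cdot> column j A) *s column j A) \<cdot> column h A = (if h = j then 1 else 0)"
    if "j \<in> ani_cols A" "h \<in> ani_cols A" for j h
    using that A by (auto simp: sp_simps V_var_iff ani_cols_def)
  from independent_if_dual_family[of "ani_cols A" "\<lambda>j. inverse (column j A \<cdot> column j A) *s column j A" "\<lambda>i. column i A", OF this]
  show ?thesis unfolding rk_ani_def eq by (simp add: vec.dim_eq_card_independent card_image)
qed

lemma rk_iso_eq_dim: "rk_iso A = vec.dim ((\<lambda>i. column i A) ` (- ani_cols A))"
proof -
  have "{v \<in> columns A. isotropic v} = (\<lambda>i. column i A) ` (- ani_cols A)"
    by (auto simp: columns_def isotropic_def ani_cols_def)
  then show ?thesis unfolding rk_iso_def by simp
qed

text \<open>The columns indexed by \<open>J\<close> form a basis of the span of the isotropic columns, and the \<open>w j\<close> span a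
totally isotropic space, orthogonal to the anisotropic columns, that the form pairs perfectly with it. Then
\<open>w j \<cdot> column l A\<close> is the coordinate of the isotropic column \<open>l\<close> at \<open>j\<close>. The anisotropic columns, the
columns in \<open>J\<close> and the \<open>w j\<close> together span a nondegenerate space of dimension \<open>p + 2q\<close>.\<close>
definition frame :: "'k::field ^ 'n ^ 'd \<Rightarrow> 'n set \<Rightarrow> ('n \<Rightarrow> 'k ^ 'd) \<Rightarrow> bool" where
  "frame A J w \<longleftrightarrow> A \<in> V_var \<and> J \<inter> ani_cols A = {} \<and>
     (\<forall>j\<in>J. \<forall>k\<in>J. w j \<cdot> w k = 0) \<and>
     (\<forall>j\<in>J. \<forall>h\<in>ani_cols A \<union> J. w j \<cdot> column h A = (if h = j then 1 else 0)) \<and>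
     (\<forall>l. l \<notin> ani_cols A \<longrightarrow> column l A = (\<Sum>j\<in>J. (w j \<cdot> column l A) *s column j A))"

lemma expand_by_dual:
  assumes fin: "finite J" and dual: "\<And>j h. j \<in> J \<Longrightarrow> h \<in> J \<Longrightarrow> v j \<cdot> b h = (if h = j then 1 else (0::'k::field))"
    and x: "x \<in> vec.span (b ` J)"
  shows "x = (\<Sum>j\<in>J. (v j \<cdot> x) *s b j)"
proof -
  let ?E = "{x. x = (\<Sum>j\<in>J. (v j \<cdot> x) *s b j)}"
  have "vec.subspace ?E"
  proof (rule vec.subspaceI)
    show "x + y \<in> ?E" if "x \<in> ?E" "y \<in> ?E" for x y
      using that by (simp add: sp_simps vec.scale_left_distrib sum.distrib)
    show "c *s x \<in> ?E" if "x \<in> ?E" for c x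
    proof -
      have "x = (\<Sum>j\<in>J. (v j \<cdot> x) *s b j)" using that by simp
      then have "c *s x = c *s (\<Sum>j\<in>J. (v j \<cdot> x) *s b j)" by simp
      also have "\<dots> = (\<Sum>j\<in>J. (v j \<cdot> (c *s x)) *s b j)"
        by (simp add: vec.scale_sum_right sp_simps)
      finally show ?thesis by simp
    qed
  qed simp
  moreover have "b ` J \<subseteq> ?E"
  proof
    fix y assume "y \<in> b ` J"
    then obtain h where h: "h \<in> J" "y = b h" by blast
    have "(\<Sum>j\<in>J. (v j \<cdot> b h) *s b j) = (\<Sum>j\<in>J. if j = h then b h else 0)"
      using h(1) dual by (intro sum.cong) auto
    then show "y \<in> ?E" using h fin by simp
  qed
  ultimately show ?thesis using vec.span_minimal[of "b ` J" ?E] x by blast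
qed

text \<open>Start with any vectors \<open>v j\<close> dual to the chosen isotropic columns, project them to the orthogonal
complement of the anisotropic columns, and finally subtract half of their Gram matrix applied to the
isotropic columns: since those are orthogonal to each other, this cancels all products of the corrected
vectors without changing their products with columns.\<close>
lemma frame_exists:
  fixes A :: "'k::field ^ 'n ^ 'd"
  assumes two: "(2::'k) \<noteq> 0" and A: "A \<in> V_var" and J: "J \<inter> ani_cols A = {}"
    and inj: "inj_on (\<lambda>j. column j A) J" and ind: "vec.independent ((\<lambda>j. column j A) ` J)"
    and sp: "(\<lambda>j. column j A) ` (- ani_cols A) \<subseteq> vec.span ((\<lambda>j. column j A) ` J)"
  shows "\<exists>w. frame A J w"
proof -
  let ?a = "\<lambda>j. column j A" and ?I = "ani_cols A"
  have orth: "?a i \<cdot> ?a j = 0" if "i \<noteq> j" for i j using A that by (simp add: V_var_iff)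
  have iso: "?a j \<cdot> ?a k = 0" if "j \<in> J" for j k
    using J that orth[of j k] by (cases "j = k") (auto simp: ani_cols_def)
  obtain v where v: "\<And>j h. j \<in> J \<Longrightarrow> h \<in> J \<Longrightarrow> v j \<cdot> ?a h = (if h = j then 1 else 0)"
    using ex_dual_family[OF inj ind] by blast
  define v' where "v' j = v j - (\<Sum>i\<in>?I. (v j \<cdot> ?a i / (?a i \<cdot> ?a i)) *s ?a i)" for j
  have v'J: "v' j \<cdot> ?a h = (if h = j then 1 else 0)" if "j \<in> J" "h \<in> J" for j h
    using v[OF that] iso[OF that(2)] by (simp add: v'_def sp_simps sp_commute[of _ "?a h"])
  have v'I: "v' j \<cdot> ?a h = 0" if "j \<in> J" "h \<in> ?I" for j h
  proof -
    have "(\<Sum>i\<in>?I. v j \<cdot> ?a i / (?a i \<cdot> ?a i) * (?a i \<cdot> ?a h)) = (\<Sum>i\<in>?I. if i = h then v j \<cdot> ?a h else 0)"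
      using orth by (intro sum.cong) (auto simp: ani_cols_def)
    then show ?thesis using that(2) by (simp add: v'_def sp_simps)
  qed
  define w where "w j = v' j - (\<Sum>k\<in>J. (v' j \<cdot> v' k / 2) *s ?a k)" for j
  have wa: "w j \<cdot> ?a h = v' j \<cdot> ?a h" if "j \<in> J" for j h
    using iso by (simp add: w_def sp_simps)
  have "w j \<cdot> w k = 0" if "j \<in> J" "k \<in> J" for j k
  proof -
    have "w j \<cdot> w k = v' j \<cdot> w k - (\<Sum>i\<in>J. v' j \<cdot> v' i / 2 * (w k \<cdot> ?a i))"
      by (simp add: w_def[of j] sp_simps sp_commute[of _ "w k"])
    also have "(\<Sum>i\<in>J. v' j \<cdot> v' i / 2 * (w k \<cdot> ?a i)) = (\<Sum>i\<in>J. if i = k then v' j \<cdot> v' k / 2 else 0)"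
      using that by (intro sum.cong) (auto simp: wa v'J)
    also have "\<dots> = v' j \<cdot> v' k / 2" using that by simp
    also have "v' j \<cdot> w k = v' j \<cdot> v' k - (\<Sum>i\<in>J. v' k \<cdot> v' i / 2 * (v' j \<cdot> ?a i))"
      by (simp add: w_def sp_simps)
    also have "(\<Sum>i\<in>J. v' k \<cdot> v' i / 2 * (v' j \<cdot> ?a i)) = (\<Sum>i\<in>J. if i = j then v' k \<cdot> v' j / 2 else 0)"
      using that by (intro sum.cong) (auto simp: v'J)
    also have "\<dots> = v' j \<cdot> v' k / 2" using that by (simp add: sp_commute)
    finally show ?thesis using two by (simp add: field_simps)
  qed
  moreover have wd: "w j \<cdot> ?a h = (if h = j then 1 else 0)" if "j \<in> J" "h \<in> ?I \<union> J" for j h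
    using that J by (auto simp: wa v'J v'I)
  moreover have "?a l = (\<Sum>j\<in>J. (w j \<cdot> ?a l) *s ?a j)" if "l \<notin> ?I" for l
    using wd sp that by (intro expand_by_dual) auto
  ultimately have "frame A J w" unfolding frame_def using A J by blast
  then show ?thesis by blast
qed

lemma frame_rank:
  assumes F: "frame A J w"
  shows "inj_on (\<lambda>j. column j A) J" "vec.independent ((\<lambda>j. column j A) ` J)" "rk_iso A = card J"
proof -
  have dual: "w j \<cdot> column h A = (if h = j then 1 else 0)" if "j \<in> J" "h \<in> J" for j h
    using F that unfolding frame_def by blast
  show inj: "inj_on (\<lambda>j. column j A) J" and ind: "vec.independent ((\<lambda>j. column j A) ` J)"
    using independent_if_dual_family[of J w "\<lambda>j. column j A", OF dual] by blast+
  have "column l A \<in> vec.span ((\<lambda>j. column j A) ` J)" if "l \<notin> ani_cols A" for l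
  proof -
    have "(\<Sum>j\<in>J. (w j \<cdot> column l A) *s column j A) \<in> vec.span ((\<lambda>j. column j A) ` J)"
      by (intro vec.span_sum vec.span_scale vec.span_base) auto
    moreover have "column l A = (\<Sum>j\<in>J. (w j \<cdot> column l A) *s column j A)"
      using F that unfolding frame_def by blast
    ultimately show ?thesis by (rule back_subst[of "\<lambda>x. x \<in> _", OF _ sym])
  qed
  moreover have "(\<lambda>j. column j A) ` J \<subseteq> (\<lambda>j. column j A) ` (- ani_cols A)"
    using F unfolding frame_def by blast
  ultimately have "vec.dim ((\<lambda>j. column j A) ` (- ani_cols A)) = card ((\<lambda>j. column j A) ` J)"
    using ind by (intro vec.dim_unique[where B = "(\<lambda>j. column j A) ` J"]) auto
  then show "rk_iso A = card J" unfolding rk_iso_eq_dim using inj by (simp add: card_image)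
qed

lemma ex_frame:
  fixes A :: "'k::field ^ 'n ^ 'd"
  assumes two: "(2::'k) \<noteq> 0" and A: "A \<in> V_var"
  shows "\<exists>J w. frame A J w"
proof -
  let ?S = "(\<lambda>i. column i A) ` (- ani_cols A)"
  obtain B where B: "B \<subseteq> ?S" "vec.independent B" "?S \<subseteq> vec.span B"
    using vec.maximal_independent_subset by blast
  then obtain J where J: "J \<subseteq> - ani_cols A" "inj_on (\<lambda>i. column i A) J" "B = (\<lambda>i. column i A) ` J"
    using subset_image_inj by metis
  then show ?thesis using frame_exists[OF two A, of J] B by blast
qed

text \<open>The rescaled anisotropic columns are dual to themselves, and the columns in \<open>J\<close> and the vectors \<open>w j\<close>
are dual to each other. The disjoint sum of index sets makes this one family.\<close>
lemma frame_nondegenerate: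
  fixes A :: "'k::field ^ 'n ^ 'd"
  assumes F: "frame A J w"
  defines "E \<equiv> (\<lambda>h. column h A) ` (ani_cols A \<union> J) \<union> w ` J"
  shows "vec.independent E" "card E = card (ani_cols A) + 2 * card J"
proof -
  let ?a = "\<lambda>j. column j A" and ?I = "ani_cols A"
  define b where "b x = (case x of Inl h \<Rightarrow> ?a h | Inr j \<Rightarrow> w j)" for x :: "'n + 'n"
  define v where "v x = (case x of Inl h \<Rightarrow> if h \<in> J then w h else inverse (?a h \<cdot> ?a h) *s ?a h | Inr j \<Rightarrow> ?a j)" for x :: "'n + 'n"
  let ?H = "(?I \<union> J) <+> J"
  have A: "A \<in> V_var" and J: "J \<inter> ?I = {}" using F unfolding frame_def by blast+
  have ww: "w j \<cdot> w k = 0" if "j \<in> J" "k \<in> J" for j k using F that unfolding frame_def by blast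
  have wa: "w j \<cdot> ?a h = (if h = j then 1 else 0)" if "j \<in> J" "h \<in> ?I \<union> J" for j h
    using F that unfolding frame_def by blast
  have aa: "?a i \<cdot> ?a j = 0" if "i \<noteq> j \<or> i \<notin> ?I" for i j
    using A that by (cases "i = j") (auto simp: V_var_iff ani_cols_def)
  have aw: "?a h \<cdot> w j = (if h = j then 1 else 0)" if "j \<in> J" "h \<in> ?I \<union> J" for j h
    using wa[OF that] by (simp add: sp_commute)
  have nz: "?a i \<cdot> ?a i \<noteq> 0" if "i \<in> ?I" for i using that by (simp add: ani_cols_def)
  have "v x \<cdot> b y = (if y = x then 1 else 0)" if "x \<in> ?H" "y \<in> ?H" for x y
  proof (cases x; cases y)
    fix h h' assume "x = Inl h" "y = Inl h'"
    then show ?thesis using that J nz wa by (auto simp: v_def b_def sp_simps aa split: if_splits)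
  next
    fix h j assume "x = Inl h" "y = Inr j"
    then show ?thesis using that J ww aw by (auto simp: v_def b_def sp_simps split: if_splits)
  next
    fix h j assume "x = Inr j" "y = Inl h"
    then have "j \<in> J" "j \<notin> ?I" using that J by auto
    then show ?thesis using aa[of j h] \<open>x = Inr j\<close> \<open>y = Inl h\<close> by (simp add: v_def b_def)
  next
    fix j k assume "x = Inr j" "y = Inr k"
    then show ?thesis using that aw by (auto simp: v_def b_def)
  qed
  note * = independent_if_dual_family[of ?H v b, OF this]
  have "b ` ?H = E" unfolding E_def b_def by (force simp: image_iff)
  then show "vec.independent E" using *(2) by simp
  have "card E = card ?H" using card_image[OF *(1)] \<open>b ` ?H = E\<close> by simp
  also have "\<dots> = card (?I \<union> J) + card J" by (simp add: card_Plus)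
  also have "card (?I \<union> J) = card ?I + card J" using J by (intro card_Un_disjoint) auto
  finally show "card E = card ?I + 2 * card J" by simp
qed

lemma frame_card_le:
  fixes A :: "'k::field ^ 'n ^ 'd"
  assumes F: "frame A J w"
  shows "card (ani_cols A) + 2 * card J \<le> CARD('d)"
  using vec.independent_card_le_dim[OF subset_UNIV frame_nondegenerate(1)[OF F]]
    frame_nondegenerate(2)[OF F] by (simp add: card_cart_basis)

text \<open>The vectors of the frame span a nondegenerate space that is not everything. Its orthogonal complement
contains a nonzero \<open>u\<close>, and some \<open>v'\<close> that is not orthogonal to \<open>u\<close>: the projection of any \<open>v\<close> with
\<open>v \<cdot> u \<noteq> 0\<close>. By polarization, one of \<open>u\<close>, \<open>v'\<close> and \<open>u + v'\<close> is anisotropic.\<close>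
lemma ex_anisotropic_orthogonal:
  fixes A :: "'k::field ^ 'n ^ 'd"
  assumes two: "(2::'k) \<noteq> 0" and F: "frame A J w"
    and less: "card (ani_cols A) + 2 * card J < CARD('d)"
  shows "\<exists>u. u \<cdot> u \<noteq> 0 \<and> (\<forall>i. u \<cdot> column i A = 0)"
proof -
  let ?a = "\<lambda>j. column j A" and ?I = "ani_cols A"
  let ?E = "?a ` (?I \<union> J) \<union> w ` J"
  have A: "A \<in> V_var" and J: "J \<inter> ?I = {}" using F unfolding frame_def by blast+
  have ww: "w j \<cdot> w k = 0" if "j \<in> J" "k \<in> J" for j k using F that unfolding frame_def by blast
  have wa: "w j \<cdot> ?a h = (if h = j then 1 else 0)" if "j \<in> J" "h \<in> ?I \<union> J" for j h
    using F that unfolding frame_def by blast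
  have aa: "?a i \<cdot> ?a j = 0" if "i \<noteq> j \<or> i \<notin> ?I" for i j
    using A that by (cases "i = j") (auto simp: V_var_iff ani_cols_def)
  have "vec.dim ?E < CARD('d)"
    using frame_nondegenerate[OF F] less by (simp add: vec.dim_eq_card_independent)
  then obtain u where u0: "u \<noteq> 0 \<and> (\<forall>s\<in>?E. u \<cdot> s = 0)" using ex_nonzero_orthogonal[of ?E] by auto
  then have u: "u \<noteq> 0" "\<And>s. s \<in> ?E \<Longrightarrow> u \<cdot> s = 0" by simp_all
  obtain v where v: "v \<cdot> u \<noteq> 0" using sp_nondegenerate[OF u(1)] by blast
  define v' where "v' = v - (\<Sum>i\<in>?I. (v \<cdot> ?a i / (?a i \<cdot> ?a i)) *s ?a i)
     - (\<Sum>j\<in>J. (v \<cdot> w j) *s ?a j) - (\<Sum>j\<in>J. (v \<cdot> ?a j) *s w j)"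
  have ua: "u \<cdot> ?a h = 0" and au: "?a h \<cdot> u = 0" if "h \<in> ?I \<union> J" for h
    using u(2)[of "?a h"] that sp_commute[of u "?a h"] by auto
  have wu: "w h \<cdot> u = 0" if "h \<in> J" for h
    using u(2)[of "w h"] that sp_commute[of u "w h"] by auto
  have "(\<Sum>i\<in>?I. v \<cdot> ?a i / (?a i \<cdot> ?a i) * (?a i \<cdot> u)) = 0"
      "(\<Sum>j\<in>J. v \<cdot> w j * (?a j \<cdot> u)) = 0" "(\<Sum>j\<in>J. v \<cdot> ?a j * (w j \<cdot> u)) = 0"
    by (intro sum.neutral; simp add: au wu)+
  then have v'u: "v' \<cdot> u = v \<cdot> u"
    by (simp add: v'_def sp_simps)
  have v'I: "v' \<cdot> ?a h = 0" if "h \<in> ?I" for h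
  proof -
    have "(\<Sum>i\<in>?I. v \<cdot> ?a i / (?a i \<cdot> ?a i) * (?a i \<cdot> ?a h)) = (\<Sum>i\<in>?I. if i = h then v \<cdot> ?a h else 0)"
    proof (intro sum.cong refl)
      fix i assume "i \<in> ?I"
      then have "?a i \<cdot> ?a i \<noteq> 0" by (simp add: ani_cols_def)
      then show "v \<cdot> ?a i / (?a i \<cdot> ?a i) * (?a i \<cdot> ?a h) = (if i = h then v \<cdot> ?a h else 0)"
        using aa[of i h] by (cases "i = h") auto
    qed
    moreover have "(\<Sum>j\<in>J. v \<cdot> w j * (?a j \<cdot> ?a h)) = 0"
    proof (intro sum.neutral ballI)
      fix j assume "j \<in> J"
      then have "j \<notin> ?I" using J by blast
      then show "v \<cdot> w j * (?a j \<cdot> ?a h) = 0" using aa[of j h] by simp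
    qed
    moreover have "(\<Sum>j\<in>J. v \<cdot> ?a j * (w j \<cdot> ?a h)) = 0"
    proof (intro sum.neutral ballI)
      fix j assume "j \<in> J"
      then have "w j \<cdot> ?a h = 0" using J that wa[of j h] by auto
      then show "v \<cdot> ?a j * (w j \<cdot> ?a h) = 0" by simp
    qed
    ultimately show ?thesis using that unfolding v'_def sp_diff_left sp_sum_left sp_scale_left by simp
  qed
  have v'J: "v' \<cdot> ?a h = 0" if "h \<in> J" for h
  proof -
    have nI: "h \<notin> ?I" using that J by blast
    have "(\<Sum>i\<in>?I. v \<cdot> ?a i / (?a i \<cdot> ?a i) * (?a i \<cdot> ?a h)) = 0"
    proof (intro sum.neutral ballI)
      fix i assume "i \<in> ?I"
      then have "?a i \<cdot> ?a h = 0" using aa[of i h] nI by metis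
      then show "v \<cdot> ?a i / (?a i \<cdot> ?a i) * (?a i \<cdot> ?a h) = 0" by simp
    qed
    moreover have "(\<Sum>j\<in>J. v \<cdot> w j * (?a j \<cdot> ?a h)) = 0"
    proof (intro sum.neutral ballI)
      fix j assume "j \<in> J"
      then have "?a j \<cdot> ?a h = 0" using aa[of j h] J by blast
      then show "v \<cdot> w j * (?a j \<cdot> ?a h) = 0" by simp
    qed
    moreover have "(\<Sum>j\<in>J. v \<cdot> ?a j * (w j \<cdot> ?a h)) = (\<Sum>j\<in>J. if j = h then v \<cdot> ?a h else 0)"
      using that by (intro sum.cong refl) (simp add: wa)
    ultimately show ?thesis using that unfolding v'_def sp_diff_left sp_sum_left sp_scale_left by simp
  qed
  have all: "x \<cdot> ?a l = 0" if "\<And>h. h \<in> ?I \<union> J \<Longrightarrow> x \<cdot> ?a h = 0" for x l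
  proof (cases "l \<in> ?I")
    case False
    then have "?a l = (\<Sum>j\<in>J. (w j \<cdot> ?a l) *s ?a j)" using F unfolding frame_def by blast
    then have "x \<cdot> ?a l = x \<cdot> (\<Sum>j\<in>J. (w j \<cdot> ?a l) *s ?a j)" by (rule arg_cong)
    also have "\<dots> = 0" using that by (simp add: sp_simps)
    finally show ?thesis .
  qed (use that in blast)
  have u_all: "u \<cdot> ?a l = 0" and v_all: "v' \<cdot> ?a l = 0" for l
    using all ua v'I v'J by blast+
  have "(u + v') \<cdot> (u + v') = u \<cdot> u + v' \<cdot> v' + 2 * (v' \<cdot> u)"
    by (simp add: sp_simps sp_commute[of u v'])
  then have "u \<cdot> u \<noteq> 0 \<or> v' \<cdot> v' \<noteq> 0 \<or> (u + v') \<cdot> (u + v') \<noteq> 0"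
    using two v v'u by force
  moreover have "(u + v') \<cdot> ?a l = 0" for l using u_all v_all by (simp add: sp_simps)
  ultimately show ?thesis using u_all v_all by blast
qed

section \<open>Lines and deformations\<close>

lemma openin_zariski_nonzero:
  assumes "f \<in> polynomial_functions" shows "openin zariski {B. f B \<noteq> 0}"
proof -
  have "closedin zariski (zero_locus {f})" using assms closedin_zariski by blast
  moreover have "{B. f B \<noteq> 0} = topspace zariski - zero_locus {f}"
    by (auto simp: topspace_zariski zero_locus_def)
  ultimately show ?thesis by (simp only: openin_diff openin_topspace)
qed

text \<open>Noetherian induction on the closure of \<open>T\<close>: if \<open>T\<close> is covered by two closed sets neither of which contains
it, both parts have smaller closures.\<close>
lemma finite_union_of_irreducible_sets:
  "\<exists>\<E>. finite \<E> \<and> (\<forall>E\<in>\<E>. irreducible_in zariski E) \<and> (T :: ('k::field ^ 'n ^ 'd) set) = \<Union>\<E>"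
proof -
  let ?P = "\<lambda>T :: ('k ^ 'n ^ 'd) set. \<exists>\<E>. finite \<E> \<and> (\<forall>E\<in>\<E>. irreducible_in zariski E) \<and> T = \<Union>\<E>"
  have "\<forall>T. zariski closure_of T = Z \<longrightarrow> ?P T" for Z :: "('k ^ 'n ^ 'd) set"
  proof (induction Z rule: wf_induct_rule[OF wf_zariski_closed])
    case (1 Z)
    show ?case
    proof (intro allI impI)
      fix T assume T: "zariski closure_of T = Z"
      show "?P T"
      proof (cases "T = {} \<or> irreducible_in zariski T")
        case True
        then show ?thesis
        proof
          assume "T = {}"
          then show ?thesis by (intro exI[of _ "{}"]) auto
        next
          assume "irreducible_in zariski T"
          then show ?thesis by (intro exI[of _ "{T}"]) auto
        qed
      next
        case False
        then obtain C D where CD: "closedin zariski C" "closedin zariski D" "T \<subseteq> C \<union> D" "\<not> T \<subseteq> C" "\<not> T \<subseteq> D"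
          unfolding irreducible_in_def topspace_zariski by auto
        have part: "?P (T \<inter> C)" if C: "closedin zariski C" "\<not> T \<subseteq> C" for C
        proof -
          have "zariski closure_of (T \<inter> C) \<subseteq> C" using C(1) by (intro closure_of_minimal) auto
          moreover have "T \<subseteq> Z" using T closure_of_subset[of T zariski] by (auto simp: topspace_zariski)
          moreover have "zariski closure_of (T \<inter> C) \<subseteq> Z"
            using T closure_of_mono[of "T \<inter> C" T zariski] by auto
          ultimately have "zariski closure_of (T \<inter> C) \<subset> Z" using C(2) by blast
          moreover have "closedin zariski Z" using T by auto
          ultimately have "(zariski closure_of (T \<inter> C), Z) \<in>
              {(Z', Z). closedin zariski Z' \<and> closedin zariski Z \<and> Z' \<subset> Z}" by simp
          from 1[OF this] show ?thesis by simp
        qed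
        obtain E1 where E1: "finite E1" "\<forall>E\<in>E1. irreducible_in zariski E" "T \<inter> C = \<Union>E1"
          using part[OF CD(1,4)] by (elim exE conjE)
        obtain E2 where E2: "finite E2" "\<forall>E\<in>E2. irreducible_in zariski E" "T \<inter> D = \<Union>E2"
          using part[OF CD(2,5)] by (elim exE conjE)
        have "T = (T \<inter> C) \<union> (T \<inter> D)" using CD(3) by auto
        also have "\<dots> = \<Union>(E1 \<union> E2)" unfolding E1(3) E2(3) by simp
        finally have "T = \<Union>(E1 \<union> E2)" .
        moreover have "finite (E1 \<union> E2)" "\<forall>E\<in>E1 \<union> E2. irreducible_in zariski E" using E1 E2 by auto
        ultimately show ?thesis by (intro exI[of _ "E1 \<union> E2"] conjI)
      qed
    qed
  qed
  then show ?thesis by simp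
qed

lemma infinite_UNIV_alg_closed: "infinite (UNIV :: 'k::alg_closed_field set)"
proof
  assume fin: "finite (UNIV :: 'k set)"
  let ?Q = "\<Prod>x\<in>UNIV. [:- x, 1:] :: 'k poly"
  have "degree ?Q = (\<Sum>x\<in>(UNIV :: 'k set). 1)"
    by (subst degree_prod_eq_sum_degree) auto
  also have "\<dots> > 0" using fin by (simp add: card_gt_0_iff)
  finally have "degree (?Q + 1) > 0" by (subst degree_add_eq_left) auto
  then obtain x where "poly (?Q + 1) x = 0" using alg_closed_imp_poly_has_root by blast
  moreover have "poly ?Q x = 0" using fin by (simp add: poly_prod prod_zero_iff)
  ultimately show False by simp
qed

definition on_line :: "'k::comm_ring_1 ^ 'n ^ 'd \<Rightarrow> 'k ^ 'n ^ 'd \<Rightarrow> 'k \<Rightarrow> 'k ^ 'n ^ 'd" where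
  "on_line A X t = (\<chi> i j. A $ i $ j + t * X $ i $ j)"

lemma on_line_0: "on_line A X 0 = A"
  by (simp add: on_line_def vec_eq_iff)

lemma column_on_line: "column j (on_line A X t) = column j A + t *s column j X"
  by (simp add: on_line_def column_def vec_eq_iff)

lemma polynomial_function_on_line:
  assumes "f \<in> polynomial_functions" shows "\<exists>P. \<forall>t. f (on_line A X t) = poly P t"
  using assms
proof induction
  case (const c)
  show ?case by (intro exI[of _ "[:c:]"]) simp
next
  case (coord i j)
  show ?case by (intro exI[of _ "[:A $ i $ j, X $ i $ j:]"]) (simp add: on_line_def)
next
  case (add f g)
  then obtain P Q where "\<And>t. f (on_line A X t) = poly P t" "\<And>t. g (on_line A X t) = poly Q t" by blast
  then show ?case by (intro exI[of _ "P + Q"]) simp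
next
  case (mult f g)
  then obtain P Q where "\<And>t. f (on_line A X t) = poly P t" "\<And>t. g (on_line A X t) = poly Q t" by blast
  then show ?case by (intro exI[of _ "P * Q"]) simp
qed

text \<open>Some polynomial function vanishes outside \<open>N\<close> but not at the given point of the line; restricted to the
line it is a nonzero polynomial in the parameter.\<close>
lemma line_meets_open_cofinitely:
  fixes A X :: "'k::idom ^ 'n ^ 'd"
  assumes N: "openin zariski N" and t0: "on_line A X t0 \<in> N"
  shows "finite {t. on_line A X t \<notin> N}"
proof -
  have "closedin zariski (- N)"
    using N openin_closedin_eq[of zariski N] by (simp add: topspace_zariski Compl_eq_Diff_UNIV)
  then obtain F where F: "F \<subseteq> polynomial_functions" "- N = zero_locus F" using closedin_zariski by blast
  then obtain f where f: "f \<in> F" "f (on_line A X t0) \<noteq> 0" using t0 by (auto simp: zero_locus_def)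
  obtain P where P: "\<And>t. f (on_line A X t) = poly P t"
    using polynomial_function_on_line f(1) F(1) by blast
  have "{t. on_line A X t \<notin> N} \<subseteq> {t. poly P t = 0}"
    using F(2) f(1) by (auto simp: zero_locus_def P[symmetric])
  moreover have "P \<noteq> 0" using f(2) P by auto
  ultimately show ?thesis using poly_roots_finite finite_subset by blast
qed

text \<open>Over an infinite field, two cofinite sets of parameters meet: that of \<open>S\<close> and that of an open
neighbourhood of \<open>A\<close>, the point with parameter \<open>0\<close>.\<close>
lemma closure_of_along_line:
  fixes A X :: "'k::idom ^ 'n ^ 'd"
  assumes inf: "infinite (UNIV :: 'k set)" and cofin: "finite {t. on_line A X t \<notin> S}"
  shows "A \<in> zariski closure_of S"
  unfolding in_closure_of
proof (intro conjI allI impI)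
  show "A \<in> topspace zariski" by (simp add: topspace_zariski)
  fix N assume "A \<in> N \<and> openin zariski N"
  then have "finite {t. on_line A X t \<notin> N}"
    using line_meets_open_cofinitely[of N A X 0] by (simp add: on_line_0)
  then have "finite ({t. on_line A X t \<notin> N} \<union> {t. on_line A X t \<notin> S})" using cofin by simp
  then obtain t where "t \<notin> {t. on_line A X t \<notin> N} \<union> {t. on_line A X t \<notin> S}"
    using inf ex_new_if_finite by metis
  then show "\<exists>y. y \<in> S \<and> y \<in> N" by blast
qed

definition of_columns :: "('n \<Rightarrow> 'k ^ 'd) \<Rightarrow> 'k ^ 'n ^ 'd" where
  "of_columns f = (\<chi> i j. f j $ i)"

lemma column_of_columns: "column j (of_columns f) = f j"
  by (simp add: of_columns_def column_def vec_eq_iff)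

lemma closedin_V_var: "closedin zariski (V_var :: ('k::field ^ 'n ^ 'd) set)"
proof -
  have sum: "(\<lambda>A. \<Sum>i\<in>S. f i A) \<in> polynomial_functions"
    if "\<And>i. i \<in> S \<Longrightarrow> f i \<in> polynomial_functions" for f :: "'d \<Rightarrow> 'k ^ 'n ^ 'd \<Rightarrow> 'k" and S
    using that
    by (induction S rule: infinite_finite_induct) (auto intro: polynomial_functions.const polynomial_functions.add)
  let ?F = "(\<lambda>(i, j). \<lambda>A :: 'k ^ 'n ^ 'd. column i A \<cdot> column j A) ` {(i, j). i \<noteq> j}"
  have "?F \<subseteq> polynomial_functions"
    by (auto simp: scalar_product_def column_def intro!: sum polynomial_functions.mult polynomial_functions.coord)
  moreover have "V_var = zero_locus ?F" by (auto simp: V_var_iff zero_locus_def)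
  ultimately show ?thesis using closedin_zariski by blast
qed

lemma deform_by_anisotropic_vector:
  fixes A :: "'k::field ^ 'n ^ 'd"
  assumes A: "A \<in> V_var" and u: "u \<cdot> u \<noteq> 0" "\<And>i. u \<cdot> column i A = 0" and l: "l \<notin> ani_cols A"
  shows "\<exists>X. \<forall>t. t \<noteq> 0 \<longrightarrow> on_line A X t \<in> V_var \<and> ani_cols A \<subset> ani_cols (on_line A X t)"
proof (intro exI allI impI conjI)
  fix t :: 'k assume t: "t \<noteq> 0"
  define X where "X = of_columns (\<lambda>i. if i = l then u else 0)"
  have u': "column i A \<cdot> u = 0" for i using u(2)[of i] by (simp add: sp_commute)
  have sp: "column i (on_line A X t) \<cdot> column j (on_line A X t) =
      column i A \<cdot> column j A + (if i = l \<and> j = l then t * t * (u \<cdot> u) else 0)" for i j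
    by (simp add: X_def column_on_line column_of_columns sp_simps u u')
  show "on_line A (of_columns (\<lambda>i. if i = l then u else 0)) t \<in> V_var"
    using A unfolding X_def[symmetric] by (simp add: V_var_iff sp)
  show "ani_cols A \<subset> ani_cols (on_line A (of_columns (\<lambda>i. if i = l then u else 0)) t)"
    using l t u(1) unfolding X_def[symmetric] by (auto simp: ani_cols_def sp)
qed

text \<open>Let \<open>u l j\<close> be the coordinates of the isotropic columns and \<open>g\<close> a vector supported on \<open>J\<close>. Move the
column \<open>j\<close> in \<open>J\<close> in the direction \<open>g\<^sub>j w\<^sub>j\<close> and a redundant column \<open>l\<close> in the direction
\<open>- (\<Sum>j\<in>J. g\<^sub>j u\<^sub>l\<^sub>j w\<^sub>j)\<close>. The directions are orthogonal to each other, so only terms linear in \<open>t\<close> occur. They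
cancel between distinct columns if one of them is in \<open>J\<close>, and for two redundant columns they add up to
\<open>- 2 (\<Sum>j\<in>J. g\<^sub>j u\<^sub>l\<^sub>j u\<^sub>m\<^sub>j)\<close>. There are fewer pairs of redundant columns than elements of \<open>J\<close>, so a nonzero \<open>g\<close>
makes all of these sums vanish; the product of the moved column \<open>j\<close> with itself is \<open>2 t g\<^sub>j\<close>.\<close>
lemma deform_by_dual_vectors:
  fixes A :: "'k::field ^ 'n ^ 'd"
  assumes two: "(2::'k) \<noteq> 0" and F: "frame A J w"
    and big: "card (- (ani_cols A \<union> J)) choose 2 < card J"
  shows "\<exists>X. \<forall>t. t \<noteq> 0 \<longrightarrow> on_line A X t \<in> V_var \<and> ani_cols A \<subset> ani_cols (on_line A X t)"
proof -
  let ?a = "\<lambda>j. column j A" and ?I = "ani_cols A"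
  let ?L = "- (?I \<union> J)"
  have A: "A \<in> V_var" and J: "J \<inter> ?I = {}" using F unfolding frame_def by blast+
  have ww: "w j \<cdot> w k = 0" if "j \<in> J" "k \<in> J" for j k using F that unfolding frame_def by blast
  have wa: "w j \<cdot> ?a h = (if h = j then 1 else 0)" if "j \<in> J" "h \<in> ?I \<union> J" for j h
    using F that unfolding frame_def by blast
  define u where "u l j = w j \<cdot> ?a l" for l j
  \<comment> \<open>The unit vectors in \<open>?S\<close> force \<open>g\<close> to be supported on \<open>J\<close>, the others are the equations for the pairs.\<close>
  let ?r = "\<lambda>B. \<chi> j. \<Prod>l\<in>B. u l j"
  let ?S = "(\<lambda>i. axis i 1) ` (- J) \<union> ?r ` {B. B \<subseteq> ?L \<and> card B = 2}"
  have "vec.dim ?S \<le> card ?S" by (rule vec.dim_le_card') simp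
  also have "\<dots> \<le> card ((\<lambda>i. axis i (1::'k)) ` (- J)) + card (?r ` {B. B \<subseteq> ?L \<and> card B = 2})"
    by (rule card_Un_le)
  also have "\<dots> \<le> card (- J) + card {B. B \<subseteq> ?L \<and> card B = 2}"
    by (intro add_mono card_image_le) auto
  also have "card {B. B \<subseteq> ?L \<and> card B = 2} = card ?L choose 2" by (rule n_subsets) simp
  also have "card (- J) + (card ?L choose 2) < card (- J) + card J" using big by simp
  also have "\<dots> = CARD('n)"
    using card_Un_disjoint[of "- J" J] by simp
  finally obtain g where g: "g \<noteq> 0" "\<forall>s\<in>?S. g \<cdot> s = 0" using ex_nonzero_orthogonal[of ?S] by auto
  have gJ: "g $ i = 0" if "i \<notin> J" for i
    using g(2) that sp_axis[of i g] by (auto simp: sp_commute[of g])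
  then obtain j0 where j0: "j0 \<in> J" "g $ j0 \<noteq> 0" using g(1) by (auto simp: vec_eq_iff)
  have gL: "(\<Sum>j\<in>J. g $ j * (u l j * u m j)) = 0" if "l \<in> ?L" "m \<in> ?L" "l \<noteq> m" for l m
  proof -
    have "{l, m} \<subseteq> ?L" "card {l, m} = 2" using that by auto
    then have "g \<cdot> ?r {l, m} = 0" using g(2) by blast
    moreover have "g \<cdot> ?r {l, m} = (\<Sum>j\<in>J. g $ j * (u l j * u m j))"
      unfolding scalar_product_def using that(3) gJ
      by (intro sum.mono_neutral_cong_right) auto
    ultimately show ?thesis by simp
  qed
  define s where "s l j = (if l \<in> ?I then 0 else if l \<in> J then (if l = j then g $ j else 0) else - (g $ j * u l j))" for l j
  define f where "f l = (\<Sum>j\<in>J. s l j *s w j)" for l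
  have ff: "f l \<cdot> f m = 0" for l m
    by (auto simp: f_def sp_simps ww intro!: sum.neutral)
  have af: "?a l \<cdot> f m = (\<Sum>j\<in>J. s m j * u l j)" for l m
    by (simp add: f_def sp_simps u_def sp_commute[of "?a l"])
  have uI: "u l j = 0" if "l \<in> ?I" "j \<in> J" for l j using wa[OF that(2)] that J by (auto simp: u_def)
  have uJ: "u l j = (if l = j then 1 else 0)" if "l \<in> J" "j \<in> J" for l j using wa[OF that(2)] that by (auto simp: u_def)
  have cross: "?a l \<cdot> f m + f l \<cdot> ?a m = 0" if "l \<noteq> m" for l m
  proof -
    have "(\<Sum>j\<in>J. s m j * u l j + s l j * u m j) = 0"
    proof (cases "l \<in> ?I \<or> m \<in> ?I")
      case True
      then show ?thesis by (intro sum.neutral) (auto simp: uI s_def)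
    next
      case nI: False
      show ?thesis
      proof (cases "l \<in> J \<or> m \<in> J")
        case True
        then show ?thesis using nI that by (intro sum.neutral) (auto simp: uJ s_def)
      next
        case False
        have "(\<Sum>j\<in>J. s m j * u l j + s l j * u m j) = (\<Sum>j\<in>J. - 2 * (g $ j * (u l j * u m j)))"
          using False nI by (intro sum.cong) (auto simp: s_def algebra_simps)
        also have "\<dots> = 0" unfolding sum_distrib_left[symmetric] using gL[of l m] False nI that by simp
        finally show ?thesis .
      qed
    qed
    then show ?thesis unfolding sp_commute[of "f l"] af sum.distrib .
  qed
  let ?X = "of_columns f"
  have sp: "column i (on_line A ?X t) \<cdot> column j (on_line A ?X t) =
      ?a i \<cdot> ?a j + t * (?a i \<cdot> f j + f i \<cdot> ?a j)" for i j t
    by (simp add: column_on_line column_of_columns sp_simps ff algebra_simps)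
  have "on_line A ?X t \<in> V_var \<and> ?I \<subset> ani_cols (on_line A ?X t)" if t: "t \<noteq> 0" for t
  proof
    show "on_line A ?X t \<in> V_var" using A cross by (simp add: V_var_iff sp)
    have "?I \<subseteq> ani_cols (on_line A ?X t)"
    proof
      fix i assume i: "i \<in> ?I"
      have "?a i \<cdot> f i = 0" unfolding af using i by (simp add: s_def)
      then show "i \<in> ani_cols (on_line A ?X t)" using i by (simp add: ani_cols_def sp sp_commute[of "f i"])
    qed
    moreover have "j0 \<notin> ?I" using j0(1) J by blast
    moreover have "j0 \<in> ani_cols (on_line A ?X t)"
    proof -
      have "?a j0 \<cdot> f j0 = (\<Sum>j\<in>J. if j = j0 then g $ j0 else 0)"
        unfolding af using j0(1) \<open>j0 \<notin> ?I\<close> by (intro sum.cong) (auto simp: s_def uJ)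
      then have "?a j0 \<cdot> f j0 = g $ j0" using j0(1) by simp
      moreover have "?a j0 \<cdot> ?a j0 = 0" using \<open>j0 \<notin> ?I\<close> by (simp add: ani_cols_def)
      moreover have "g $ j0 + g $ j0 \<noteq> 0" using two j0(2) by (simp flip: mult_2)
      ultimately show ?thesis using t by (simp add: ani_cols_def sp sp_commute[of "f j0"])
    qed
    ultimately show "?I \<subset> ani_cols (on_line A ?X t)" by blast
  qed
  then show ?thesis by blast
qed

section \<open>Functions regular at a point\<close>

text \<open>\<open>f\<close> agrees near \<open>A\<close> with a quotient of polynomial functions. Values where the denominator vanishes are
arbitrary, so a function defined by division in the field qualifies as it stands.\<close>
definition regular_at :: "'k::field ^ 'n ^ 'd \<Rightarrow> ('k ^ 'n ^ 'd \<Rightarrow> 'k) \<Rightarrow> bool" where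
  "regular_at A f \<longleftrightarrow> (\<exists>u\<in>polynomial_functions. \<exists>v\<in>polynomial_functions.
     v A \<noteq> 0 \<and> (\<forall>B. v B \<noteq> 0 \<longrightarrow> f B = u B / v B))"

lemma regular_at_polynomial: "f \<in> polynomial_functions \<Longrightarrow> regular_at A f"
  unfolding regular_at_def
  by (intro bexI[of _ f] bexI[of _ "\<lambda>_. 1"]) (auto intro: polynomial_functions.const)

lemma regular_at_const: "regular_at A (\<lambda>_. c)"
  by (intro regular_at_polynomial polynomial_functions.const)

lemma regular_at_entry: "regular_at A (\<lambda>B. column j B $ i)"
  by (intro regular_at_polynomial) (simp add: column_def polynomial_functions.coord)

lemma regular_at_add:
  assumes "regular_at A f" "regular_at A g" shows "regular_at A (\<lambda>B. f B + g B)"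
proof -
  obtain u v where uv: "u \<in> polynomial_functions" "v \<in> polynomial_functions" "v A \<noteq> 0" "\<And>B. v B \<noteq> 0 \<Longrightarrow> f B = u B / v B"
    using assms(1) unfolding regular_at_def by blast
  obtain u' v' where uv': "u' \<in> polynomial_functions" "v' \<in> polynomial_functions" "v' A \<noteq> 0" "\<And>B. v' B \<noteq> 0 \<Longrightarrow> g B = u' B / v' B"
    using assms(2) unfolding regular_at_def by blast
  show ?thesis
    unfolding regular_at_def
    using uv uv'
    by (intro bexI[of _ "\<lambda>B. u B * v' B + u' B * v B"] bexI[of _ "\<lambda>B. v B * v' B"])
      (auto simp: add_frac_eq intro: polynomial_functions.add polynomial_functions.mult)
qed

lemma regular_at_mult:
  assumes "regular_at A f" "regular_at A g" shows "regular_at A (\<lambda>B. f B * g B)"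
proof -
  obtain u v where uv: "u \<in> polynomial_functions" "v \<in> polynomial_functions" "v A \<noteq> 0" "\<And>B. v B \<noteq> 0 \<Longrightarrow> f B = u B / v B"
    using assms(1) unfolding regular_at_def by blast
  obtain u' v' where uv': "u' \<in> polynomial_functions" "v' \<in> polynomial_functions" "v' A \<noteq> 0" "\<And>B. v' B \<noteq> 0 \<Longrightarrow> g B = u' B / v' B"
    using assms(2) unfolding regular_at_def by blast
  show ?thesis
    unfolding regular_at_def
    using uv uv'
    by (intro bexI[of _ "\<lambda>B. u B * u' B"] bexI[of _ "\<lambda>B. v B * v' B"])
      (auto intro: polynomial_functions.mult)
qed

lemma regular_at_inverse:
  assumes "regular_at A f" "f A \<noteq> 0" shows "regular_at A (\<lambda>B. inverse (f B))"
proof -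
  obtain u v where uv: "u \<in> polynomial_functions" "v \<in> polynomial_functions" "v A \<noteq> 0" "\<And>B. v B \<noteq> 0 \<Longrightarrow> f B = u B / v B"
    using assms(1) unfolding regular_at_def by blast
  have "u A \<noteq> 0" using assms(2) uv(3,4) by force
  then show ?thesis
    unfolding regular_at_def
    using uv
    by (intro bexI[of _ "\<lambda>B. v B * v B"] bexI[of _ "\<lambda>B. u B * v B"])
      (auto intro: polynomial_functions.mult)
qed

lemma regular_at_minus:
  assumes "regular_at A f" "regular_at A g" shows "regular_at A (\<lambda>B. f B - g B)"
  using regular_at_add[OF assms(1) regular_at_mult[OF regular_at_const[of A "-1"] assms(2)]] by simp

lemma regular_at_sum:
  "(\<And>i. i \<in> S \<Longrightarrow> regular_at A (f i)) \<Longrightarrow> regular_at A (\<lambda>B. \<Sum>i\<in>S. f i B)"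
  by (induction S rule: infinite_finite_induct) (auto intro: regular_at_const regular_at_add)

lemma regular_at_prod:
  "(\<And>i. i \<in> S \<Longrightarrow> regular_at A (f i)) \<Longrightarrow> regular_at A (\<lambda>B. \<Prod>i\<in>S. f i B)"
  by (induction S rule: infinite_finite_induct) (auto intro: regular_at_const regular_at_mult)

lemma regular_at_det:
  fixes M :: "'k::field ^ 'n ^ 'd \<Rightarrow> 'k ^ 'm ^ 'm"
  shows "(\<And>i j. regular_at A (\<lambda>B. M B $ i $ j)) \<Longrightarrow> regular_at A (\<lambda>B. det (M B))"
  unfolding det_def by (intro regular_at_sum regular_at_mult regular_at_const regular_at_prod)

lemma regular_at_scalar_product:
  fixes x y :: "'k::field ^ 'n ^ 'd \<Rightarrow> 'k ^ 'e"
  assumes "\<And>i. regular_at A (\<lambda>B. x B $ i)" "\<And>i. regular_at A (\<lambda>B. y B $ i)"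
  shows "regular_at A (\<lambda>B. x B \<cdot> y B)"
  unfolding scalar_product_def by (intro regular_at_sum regular_at_mult assms)

lemma regular_at_if:
  assumes "P \<Longrightarrow> regular_at A f" "\<not> P \<Longrightarrow> regular_at A g"
  shows "regular_at A (\<lambda>B. if P then f B else g B)"
  using assms by (cases P) auto

lemma regular_at_nonzero_nbhd:
  assumes "regular_at A f" "f A \<noteq> 0"
  shows "\<exists>N. openin zariski N \<and> A \<in> N \<and> (\<forall>B\<in>N. f B \<noteq> 0)"
proof -
  obtain u v where uv: "u \<in> polynomial_functions" "v \<in> polynomial_functions" "v A \<noteq> 0" "\<And>B. v B \<noteq> 0 \<Longrightarrow> f B = u B / v B"
    using assms(1) unfolding regular_at_def by blast
  have "openin zariski {B. u B * v B \<noteq> 0}"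
    using uv(1,2) by (intro openin_zariski_nonzero polynomial_functions.mult)
  moreover have "A \<in> {B. u B * v B \<noteq> 0}" using uv(3,4) assms(2) by force
  moreover have "\<forall>B\<in>{B. u B * v B \<noteq> 0}. f B \<noteq> 0" using uv(4) by auto
  ultimately show ?thesis by (intro exI[of _ "{B. u B * v B \<noteq> 0}"] conjI)
qed

text \<open>Cramer's rule shows that the entries of the inverse matrix are rational functions of the entries.\<close>
definition cramer_inverse :: "'k::field ^ 'n ^ 'n \<Rightarrow> 'k ^ 'n ^ 'n" where
  "cramer_inverse M = (\<chi> i j. det (\<chi> r c. if c = i then (if r = j then 1 else 0) else M $ r $ c) * inverse (det M))"

lemma cramer_inverse:
  assumes "det M \<noteq> 0"
  shows "M ** cramer_inverse M = mat 1" "cramer_inverse M ** M = mat 1"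
proof -
  have "M *v (\<chi> i. cramer_inverse M $ i $ j) = axis j 1" for j
    unfolding cramer[OF assms]
    by (simp add: cramer_inverse_def axis_def vec_eq_iff divide_inverse cong: if_cong)
  then have "(M ** cramer_inverse M) $ i $ j = mat 1 $ i $ j" for i j
    by (simp add: matrix_matrix_mult_def matrix_vector_mult_def vec_eq_iff axis_def mat_def)
  then show "M ** cramer_inverse M = mat 1" by (simp add: vec_eq_iff)
  then show "cramer_inverse M ** M = mat 1" by (simp add: matrix_left_right_inverse)
qed

lemma cramer_inverse_mat_1: "cramer_inverse (mat 1) = mat 1"
  using cramer_inverse(1)[of "mat 1"] by simp

lemma regular_at_cramer_inverse:
  fixes M :: "'k::field ^ 'n ^ 'd \<Rightarrow> 'k ^ 'm ^ 'm"
  assumes M: "\<And>i j. regular_at A (\<lambda>B. M B $ i $ j)" and "det (M A) \<noteq> 0"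
  shows "regular_at A (\<lambda>B. cramer_inverse (M B) $ i $ j)"
  unfolding cramer_inverse_def vec_lambda_beta
  by (intro regular_at_mult regular_at_inverse regular_at_det assms)
    (auto simp: M regular_at_const intro!: regular_at_if)

section \<open>Isotropy near a general point\<close>

text \<open>Let \<open>b\<^sub>i\<close> be the columns of \<open>B\<close> and \<open>G\<^sub>i = b\<^sub>i \<cdot> b\<^sub>i\<close>. Given \<open>v\<^sub>j\<close> dual to the \<open>b\<^sub>j\<close>, the vectors
\<open>c\<^sub>j = b\<^sub>j - G\<^sub>j v\<^sub>j\<close> are orthogonal to all columns in \<open>I \<union> J\<close>, and \<open>E\<close> is the matrix of the products
\<open>c\<^sub>j \<cdot> v\<^sub>k\<close>. As \<open>E\<close> is invertible and \<open>p + 2q = d\<close>, the \<open>c\<^sub>j\<close> form a basis of the orthogonal complement of the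
columns in \<open>I \<union> J\<close>. That complement contains all other columns, with coordinates \<open>u l j\<close>. Expanding
\<open>b\<^sub>l \<cdot> b\<^sub>m = 0\<close> in this basis for \<open>l = \<alpha> j\<close> and \<open>m = \<beta> j\<close> shows that the vector of the \<open>G\<^sub>i\<close> with \<open>i \<in> J\<close> is
in the kernel of \<open>M\<close>, so it vanishes. Then \<open>c\<^sub>j = b\<^sub>j\<close>. The matrices are indexed by all columns and
extended by the identity outside \<open>J\<close>.\<close>
lemma isotropy_is_forced:
  fixes B :: "'k::field ^ 'n ^ 'd" and v :: "'n \<Rightarrow> 'k ^ 'd" and E Ei M :: "'k ^ 'n ^ 'n"
  defines "G \<equiv> \<lambda>j. column j B \<cdot> column j B"
  assumes B: "B \<in> V_var" and IJ: "I \<inter> J = {}" and GI: "\<And>i. i \<in> I \<Longrightarrow> G i \<noteq> 0"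
    and full: "card I + 2 * card J = CARD('d)"
    and dual: "\<And>k h. k \<in> J \<Longrightarrow> h \<in> I \<union> J \<Longrightarrow> v k \<cdot> column h B = (if h = k then 1 else 0)"
    and E: "\<And>j k. E $ j $ k = (if j = k then 1 else 0) - (if j \<in> J \<and> k \<in> J then G j * (v j \<cdot> v k) else 0)"
    and Ei: "Ei ** E = mat 1"
    and u: "\<And>l j. u l j = (\<Sum>k\<in>J. (column l B \<cdot> v k) * Ei $ k $ j)"
    and lm: "\<And>j. j \<in> J \<Longrightarrow> \<alpha> j \<notin> I \<union> J" "\<And>j. j \<in> J \<Longrightarrow> \<beta> j \<notin> I \<union> J" "\<And>j. j \<in> J \<Longrightarrow> \<alpha> j \<noteq> \<beta> j"
    and M: "\<And>j i. j \<in> J \<Longrightarrow> i \<in> J \<Longrightarrow>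
        M $ j $ i = u (\<alpha> j) i * u (\<beta> j) i - (\<Sum>k\<in>J. u (\<alpha> j) i * u (\<beta> j) k * (v i \<cdot> v k) * G k)"
    and M0: "\<And>j i. j \<notin> J \<or> i \<notin> J \<Longrightarrow> M $ j $ i = (if j = i then 1 else 0)"
    and detM: "det M \<noteq> 0"
  shows "\<And>j. j \<in> J \<Longrightarrow> G j = 0" and "\<And>l. l \<notin> I \<union> J \<Longrightarrow> column l B = (\<Sum>j\<in>J. u l j *s column j B)"
proof -
  let ?b = "\<lambda>j. column j B"
  have bb: "?b i \<cdot> ?b j = 0" if "i \<noteq> j" for i j using B that by (simp add: V_var_iff)
  have bG: "?b j \<cdot> ?b j = G j" for j by (simp add: G_def)
  have bv: "?b h \<cdot> v k = (if h = k then 1 else 0)" if "k \<in> J" "h \<in> I \<union> J" for k h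
    using dual[OF that] by (simp add: sp_commute)
  have EiE: "(\<Sum>j\<in>J. Ei $ k $ j * E $ j $ k') = (if k' = k then 1 else 0)" if "k' \<in> J" for k k'
  proof -
    have "(\<Sum>j\<in>J. Ei $ k $ j * E $ j $ k') = (\<Sum>j\<in>UNIV. Ei $ k $ j * E $ j $ k')"
      using that by (intro sum.mono_neutral_left) (auto simp: E)
    also have "\<dots> = (Ei ** E) $ k $ k'" by (simp add: matrix_matrix_mult_def)
    finally show ?thesis by (simp add: Ei mat_def)
  qed
  define c where "c j = ?b j - G j *s v j" for j
  have cb: "c j \<cdot> ?b h = 0" if "j \<in> J" "h \<in> I \<union> J" for j h
    using dual[OF that] bb[of j h] bG[of h] by (cases "h = j") (simp_all add: c_def sp_simps)
  have cv: "c j \<cdot> v k = E $ j $ k" if "j \<in> J" "k \<in> J" for j k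
    using bv[of k j] that by (simp add: c_def sp_simps E)
  define e where "e k = (\<Sum>j\<in>J. Ei $ k $ j *s c j)" for k
  have eb: "e k \<cdot> ?b h = 0" if "h \<in> I \<union> J" for k h
    using cb that by (simp add: e_def sp_simps)
  have ev: "e k \<cdot> v k' = (if k' = k then 1 else 0)" if "k' \<in> J" for k k'
    using cv that EiE[OF that] by (simp add: e_def sp_simps)
  \<comment> \<open>The \<open>b\<^sub>h\<close> and the \<open>v\<^sub>k\<close> are \<open>p + 2q = d\<close> independent vectors, the \<open>e\<^sub>k\<close> being part of a dual family.\<close>
  have zero: "y = 0" if yb: "\<And>h. h \<in> I \<union> J \<Longrightarrow> y \<cdot> ?b h = 0" and yv: "\<And>k. k \<in> J \<Longrightarrow> y \<cdot> v k = 0" for y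
  proof -
    define f where "f x = (case x of Inl h \<Rightarrow> ?b h | Inr k \<Rightarrow> v k)" for x :: "'n + 'n"
    define D where "D x = (case x of Inl h \<Rightarrow> if h \<in> J then v h - (\<Sum>k\<in>J. (v h \<cdot> v k) *s e k)
        else inverse (G h) *s ?b h | Inr k \<Rightarrow> e k)" for x :: "'n + 'n"
    let ?H = "(I \<union> J) <+> J"
    have "D x \<cdot> f z = (if z = x then 1 else 0)" if x: "x \<in> ?H" and z: "z \<in> ?H" for x z
    proof (cases x; cases z)
      fix h h' assume [simp]: "x = Inl h" "z = Inl h'"
      then have h: "h \<in> I \<union> J" "h' \<in> I \<union> J" using x z by auto
      show ?thesis
      proof (cases "h \<in> J")
        case True
        then show ?thesis using dual[of h h'] h eb[OF h(2)] by (simp add: D_def f_def sp_simps)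
      next
        case False
        then show ?thesis using h GI[of h] bb[of h h'] bG[of h] by (cases "h = h'") (simp_all add: D_def f_def sp_simps)
      qed
    next
      fix h k assume [simp]: "x = Inl h" "z = Inr k"
      then have h: "h \<in> I \<union> J" "k \<in> J" using x z by auto
      show ?thesis
      proof (cases "h \<in> J")
        case True
        have "(\<Sum>i\<in>J. v h \<cdot> v i * (e i \<cdot> v k)) = (\<Sum>i\<in>J. if i = k then v h \<cdot> v k else 0)"
          using h(2) by (intro sum.cong) (auto simp: ev)
        then show ?thesis using True h by (simp add: D_def f_def sp_simps)
      next
        case False
        then show ?thesis using h bv[of k h] by (auto simp add: D_def f_def sp_simps)
      qed
    next
      fix k h assume "x = Inr k" "z = Inl h"
      then show ?thesis using x z eb[of h k] by (auto simp: D_def f_def)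
    next
      fix k k' assume "x = Inr k" "z = Inr k'"
      then show ?thesis using x z ev[of k' k] by (auto simp: D_def f_def)
    qed
    note ind = independent_if_dual_family[of ?H D f, OF this]
    have "card (f ` ?H) = card (I \<union> J) + card J" using card_image[OF ind(1)] by (simp add: card_Plus)
    also have "card (I \<union> J) = card I + card J" using IJ by (intro card_Un_disjoint) auto
    finally have "card (f ` ?H) = CARD('d)" using full by simp
    then have "vec.dim (UNIV :: ('k ^ 'd) set) \<le> card (f ` ?H)" by (simp add: card_cart_basis)
    then have "UNIV \<subseteq> vec.span (f ` ?H)"
      by (intro vec.card_ge_dim_independent[OF subset_UNIV ind(2)])
    moreover have "y \<cdot> s = 0" if "s \<in> f ` ?H" for s
      using that yb yv by (auto simp: f_def)
    ultimately have "y \<cdot> x = 0" for x using sp_span_eq_0[of "f ` ?H" y x] by blast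
    then show "y = 0" using sp_nondegenerate[of y] by (metis sp_commute)
  qed
  have expand: "?b l = (\<Sum>j\<in>J. u l j *s c j)" if l: "l \<notin> I \<union> J" for l
  proof -
    let ?y = "?b l - (\<Sum>j\<in>J. u l j *s c j)"
    have "?y \<cdot> ?b h = 0" if "h \<in> I \<union> J" for h
      using bb[of l h] l that cb[OF _ that] by (auto simp: sp_simps)
    moreover have "?y \<cdot> v k = 0" if k: "k \<in> J" for k
    proof -
      have "(\<Sum>j\<in>J. u l j * (c j \<cdot> v k)) = (\<Sum>j\<in>J. \<Sum>i\<in>J. (?b l \<cdot> v i) * (Ei $ i $ j * E $ j $ k))"
        using k by (intro sum.cong refl) (simp add: cv u sum_distrib_right mult.assoc)
      also have "\<dots> = (\<Sum>i\<in>J. (?b l \<cdot> v i) * (\<Sum>j\<in>J. Ei $ i $ j * E $ j $ k))"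
        by (subst sum.swap) (simp add: sum_distrib_left)
      also have "\<dots> = (\<Sum>i\<in>J. if i = k then ?b l \<cdot> v k else 0)"
        using EiE[OF k] by (intro sum.cong) auto
      finally show ?thesis using k by (simp add: sp_simps)
    qed
    ultimately have "?y = 0" by (rule zero)
    then show ?thesis by simp
  qed
  have cc: "c j \<cdot> c k = - (G k * E $ j $ k)" if "j \<in> J" "k \<in> J" for j k
    using cb[of j k] cv[OF that] that by (simp add: c_def[of k] sp_simps)
  let ?g = "\<chi> j. if j \<in> J then G j else 0"
  have row: "(\<Sum>i\<in>J. M $ j $ i * G i) = 0" if j: "j \<in> J" for j
  proof -
    have "0 = ?b (\<alpha> j) \<cdot> ?b (\<beta> j)" using lm(3)[OF j] by (simp add: bb)
    also have "\<dots> = (\<Sum>i\<in>J. u (\<alpha> j) i *s c i) \<cdot> (\<Sum>k\<in>J. u (\<beta> j) k *s c k)"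
      using expand[OF lm(1)[OF j]] expand[OF lm(2)[OF j]] by (simp only: )
    also have "\<dots> = (\<Sum>i\<in>J. \<Sum>k\<in>J. u (\<alpha> j) i * (u (\<beta> j) k * (c i \<cdot> c k)))"
      by (simp add: sp_simps sum_distrib_left)
        (subst sum.swap, simp add: sum_distrib_left mult.left_commute)
    also have "\<dots> = (\<Sum>i\<in>J. - (M $ j $ i * G i))"
    proof (intro sum.cong refl)
      fix i assume i: "i \<in> J"
      have "(\<Sum>k\<in>J. u (\<alpha> j) i * (u (\<beta> j) k * (c i \<cdot> c k)))
          = (\<Sum>k\<in>J. (u (\<alpha> j) i * u (\<beta> j) k * (v i \<cdot> v k) * G k) * G i - (if k = i then u (\<alpha> j) i * u (\<beta> j) i * G i else 0))"
        using i by (intro sum.cong refl) (auto simp: cc E algebra_simps)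
      also have "\<dots> = (\<Sum>k\<in>J. u (\<alpha> j) i * u (\<beta> j) k * (v i \<cdot> v k) * G k) * G i - u (\<alpha> j) i * u (\<beta> j) i * G i"
        using i by (simp add: sum_subtractf sum_distrib_right)
      also have "\<dots> = - (M $ j $ i * G i)" unfolding M[OF j i] by (simp only: left_diff_distrib minus_diff_eq)
      finally show "(\<Sum>k\<in>J. u (\<alpha> j) i * (u (\<beta> j) k * (c i \<cdot> c k))) = - (M $ j $ i * G i)" .
    qed
    finally show ?thesis by (simp add: sum_negf)
  qed
  have "(M *v ?g) $ j = 0" for j
  proof -
    have "(M *v ?g) $ j = (\<Sum>i\<in>J. M $ j $ i * G i)"
      unfolding matrix_vector_mult_def by (simp, intro sum.mono_neutral_cong_right) auto
    also have "\<dots> = 0"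
    proof (cases "j \<in> J")
      case False
      then show ?thesis by (intro sum.neutral) (auto simp: M0)
    qed (rule row)
    finally show ?thesis .
  qed
  then have "M *v ?g = 0" by (simp add: vec_eq_iff)
  moreover have "M *v 0 = 0" by (simp add: matrix_vector_mult_def vec_eq_iff)
  ultimately have g0: "?g = 0" using cramer[OF detM, of ?g 0] cramer[OF detM, of 0 0] by metis
  show G0: "G j = 0" if "j \<in> J" for j using g0 that by (auto simp: vec_eq_iff split: if_splits)
  show "?b l = (\<Sum>j\<in>J. u l j *s ?b j)" if "l \<notin> I \<union> J" for l
    using expand[OF that] G0 by (simp add: c_def)
qed

text \<open>The hypothesis on \<open>\<alpha>\<close> and \<open>\<beta>\<close> says that for each \<open>j\<close> in \<open>J\<close> the coordinate vectors of some pair of redundant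
columns have the \<open>j\<close>-th unit vector as their componentwise product. All data needed by
\<open>isotropy_is_forced\<close> are rational functions of \<open>B\<close>, and the matrices to be inverted are the identity at
\<open>A\<close>, so they remain invertible near \<open>A\<close>.\<close>
lemma V_var_near_generic_point:
  fixes A :: "'k::field ^ 'n ^ 'd"
  assumes two: "(2::'k) \<noteq> 0" and F: "frame A J w"
    and full: "card (ani_cols A) + 2 * card J = CARD('d)"
    and lm: "\<And>j. j \<in> J \<Longrightarrow> \<alpha> j \<notin> ani_cols A \<union> J" "\<And>j. j \<in> J \<Longrightarrow> \<beta> j \<notin> ani_cols A \<union> J"
      "\<And>j. j \<in> J \<Longrightarrow> \<alpha> j \<noteq> \<beta> j"
    and gen: "\<And>j i. j \<in> J \<Longrightarrow> i \<in> J \<Longrightarrow>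
      (w i \<cdot> column (\<alpha> j) A) * (w i \<cdot> column (\<beta> j) A) = (if j = i then 1 else 0)"
  shows "\<exists>N. openin zariski N \<and> A \<in> N \<and> V_var \<inter> N \<subseteq> stratum (rk_ani A) (rk_iso A)"
proof -
  let ?I = "ani_cols A"
  let ?H = "?I \<union> J"
  have A: "A \<in> V_var" and IJ: "?I \<inter> J = {}" using F unfolding frame_def by blast+
  have wa: "w j \<cdot> column h A = (if h = j then 1 else 0)" if "j \<in> J" "h \<in> ?H" for j h
    using F that unfolding frame_def by blast
  have isoA: "column j A \<cdot> column j A = 0" if "j \<in> J" for j
    using IJ that by (auto simp: ani_cols_def)
  \<comment> \<open>\<open>D\<close> is dual to the columns of \<open>A\<close> indexed by \<open>?H\<close>. The inverse of \<open>T B\<close> corrects it to a family dual to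
      those of \<open>B\<close>, of which \<open>v B\<close> is the part indexed by \<open>J\<close>.\<close>
  define D where "D h = (if h \<in> J then w h else inverse (column h A \<cdot> column h A) *s column h A)" for h
  have D: "D h \<cdot> column h' A = (if h' = h then 1 else 0)" if "h \<in> ?H" "h' \<in> ?H" for h h'
  proof (cases "h \<in> J")
    case False
    then show ?thesis using that A by (auto simp: D_def sp_simps V_var_iff ani_cols_def)
  qed (use that wa in \<open>simp add: D_def\<close>)
  define T :: "'k ^ 'n ^ 'd \<Rightarrow> 'k ^ 'n ^ 'n"
    where "T B = (\<chi> h h'. if h \<in> ?H \<and> h' \<in> ?H then D h \<cdot> column h' B else if h = h' then 1 else 0)" for B
  have TA: "T A = mat 1" by (auto simp: T_def mat_def vec_eq_iff D)
  have regT: "regular_at A (\<lambda>B. T B $ i $ j)" for i j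
    unfolding T_def vec_lambda_beta
    by (intro regular_at_if regular_at_scalar_product regular_at_const regular_at_entry)
  define v where "v B k = (\<Sum>h\<in>?H. cramer_inverse (T B) $ k $ h *s D h)" for B k
  have regv: "regular_at A (\<lambda>B. v B k $ i)" for k i
    unfolding v_def sum_component vector_smult_component
    by (intro regular_at_sum regular_at_mult regular_at_const regular_at_cramer_inverse regT) (simp add: TA)
  have vA: "v A k = w k" if "k \<in> J" for k
  proof -
    have "v A k = (\<Sum>h\<in>?H. if h = k then D k else 0)"
      unfolding v_def TA cramer_inverse_mat_1 by (intro sum.cong) (auto simp: mat_def)
    then show ?thesis using that by (simp add: D_def)
  qed
  define E :: "'k ^ 'n ^ 'd \<Rightarrow> 'k ^ 'n ^ 'n"
    where "E B = (\<chi> j k. (if j = k then 1 else 0) -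
      (if j \<in> J \<and> k \<in> J then (column j B \<cdot> column j B) * (v B j \<cdot> v B k) else 0))" for B
  have EA: "E A = mat 1" by (auto simp: E_def mat_def vec_eq_iff isoA)
  have regE: "regular_at A (\<lambda>B. E B $ i $ j)" for i j
    unfolding E_def vec_lambda_beta
    by (intro regular_at_minus regular_at_if regular_at_mult regular_at_scalar_product regular_at_const
        regular_at_entry regv)
  define u where "u B l j = (\<Sum>k\<in>J. (column l B \<cdot> v B k) * cramer_inverse (E B) $ k $ j)" for B l j
  have regu: "regular_at A (\<lambda>B. u B l j)" for l j
    unfolding u_def
    by (intro regular_at_sum regular_at_mult regular_at_scalar_product regular_at_entry regv
        regular_at_cramer_inverse regE) (simp add: EA)
  have uA: "u A l j = w j \<cdot> column l A" if "j \<in> J" for l j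
  proof -
    have "u A l j = (\<Sum>k\<in>J. if k = j then w j \<cdot> column l A else 0)"
      unfolding u_def EA cramer_inverse_mat_1
      by (intro sum.cong) (auto simp: mat_def vA sp_commute[of "column l A"])
    then show ?thesis using that by simp
  qed
  define M :: "'k ^ 'n ^ 'd \<Rightarrow> 'k ^ 'n ^ 'n"
    where "M B = (\<chi> j i. if j \<in> J \<and> i \<in> J then u B (\<alpha> j) i * u B (\<beta> j) i -
       (\<Sum>k\<in>J. u B (\<alpha> j) i * u B (\<beta> j) k * (v B i \<cdot> v B k) * (column k B \<cdot> column k B))
      else if j = i then 1 else 0)" for B
  have MA: "M A = mat 1" by (auto simp: M_def mat_def vec_eq_iff isoA uA gen)
  have regM: "regular_at A (\<lambda>B. M B $ i $ j)" for i j
    unfolding M_def vec_lambda_beta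
    by (intro regular_at_minus regular_at_if regular_at_sum regular_at_mult regular_at_scalar_product
        regular_at_const regular_at_entry regv regu)
  define f where "f B = det (T B) * det (E B) * det (M B) * (\<Prod>i\<in>?I. column i B \<cdot> column i B)" for B
  have "regular_at A f"
    unfolding f_def
    by (intro regular_at_mult regular_at_det regT regE regM regular_at_prod regular_at_scalar_product regular_at_entry)
  moreover have "f A \<noteq> 0" by (simp add: f_def TA EA MA ani_cols_def)
  ultimately have "\<exists>N. openin zariski N \<and> A \<in> N \<and> (\<forall>B\<in>N. f B \<noteq> 0)" by (rule regular_at_nonzero_nbhd)
  then obtain N where N: "openin zariski N" "A \<in> N" and fN: "\<forall>B\<in>N. f B \<noteq> 0" by (elim exE conjE)
  have "B \<in> stratum (rk_ani A) (rk_iso A)" if BV: "B \<in> V_var" and BN: "B \<in> N" for B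
  proof -
    have nz: "det (T B) \<noteq> 0" "det (E B) \<noteq> 0" "det (M B) \<noteq> 0" "\<And>i. i \<in> ?I \<Longrightarrow> column i B \<cdot> column i B \<noteq> 0"
      using bspec[OF fN BN] by (auto simp: f_def)
    have dual: "v B k \<cdot> column h B = (if h = k then 1 else 0)" if "k \<in> J" "h \<in> ?H" for k h
    proof -
      have "v B k \<cdot> column h B = (\<Sum>i\<in>?H. cramer_inverse (T B) $ k $ i * T B $ i $ h)"
        using that(2) by (simp add: v_def sp_simps T_def)
      also have "\<dots> = (\<Sum>i\<in>UNIV. cramer_inverse (T B) $ k $ i * T B $ i $ h)"
        using that(2) by (intro sum.mono_neutral_left) (auto simp: T_def)
      also have "\<dots> = (cramer_inverse (T B) ** T B) $ k $ h" by (simp add: matrix_matrix_mult_def)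
      finally show ?thesis by (simp add: cramer_inverse(2)[OF nz(1)] mat_def)
    qed
    have G0: "column j B \<cdot> column j B = 0" if "j \<in> J" for j
      by (rule isotropy_is_forced(1)[OF BV IJ nz(4) full dual _ cramer_inverse(2)[OF nz(2)] u_def lm _ _ nz(3) that])
        (auto simp: E_def M_def)
    have expand: "column l B = (\<Sum>j\<in>J. u B l j *s column j B)" if "l \<notin> ?H" for l
      by (rule isotropy_is_forced(2)[OF BV IJ nz(4) full dual _ cramer_inverse(2)[OF nz(2)] u_def lm _ _ nz(3) that])
        (auto simp: E_def M_def)
    have Gl: "column l B \<cdot> column l B = 0" if l: "l \<notin> ?H" for l
    proof -
      have "column l B \<cdot> column l B = column l B \<cdot> (\<Sum>j\<in>J. u B l j *s column j B)"
        using expand[OF l] by (rule arg_cong)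
      also have "\<dots> = (\<Sum>j\<in>J. u B l j * (column l B \<cdot> column j B))" by (simp add: sp_simps)
      also have "\<dots> = 0"
      proof (intro sum.neutral ballI)
        fix j assume "j \<in> J"
        then have "l \<noteq> j" using l by blast
        then have "column l B \<cdot> column j B = 0" using BV by (simp add: V_var_iff)
        then show "u B l j * (column l B \<cdot> column j B) = 0" by simp
      qed
      finally show ?thesis .
    qed
    have ani: "ani_cols B = ?I"
      using nz(4) G0 Gl unfolding ani_cols_def[of B] by blast
    have dualJ: "v B k \<cdot> column h B = (if h = k then 1 else 0)" if "k \<in> J" "h \<in> J" for k h
      using dual that by simp
    have "column l B \<in> vec.span ((\<lambda>j. column j B) ` J)" if "l \<notin> ?I" for l
    proof (cases "l \<in> J")
      case False
      have "(\<Sum>j\<in>J. u B l j *s column j B) \<in> vec.span ((\<lambda>j. column j B) ` J)"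
        by (intro vec.span_sum vec.span_scale vec.span_base) auto
      then show ?thesis using expand[of l] that False by simp
    qed (simp add: vec.span_base)
    then have "\<exists>w'. frame B J w'"
      using IJ ani independent_if_dual_family[of J "v B" "\<lambda>j. column j B", OF dualJ]
      by (intro frame_exists[OF two BV]) auto
    then have "rk_iso B = card J" using frame_rank(3) by blast
    then show ?thesis
      using BV ani frame_rank(3)[OF F] rk_ani_eq_card[OF A] rk_ani_eq_card[OF BV] by (simp add: stratum_def)
  qed
  then show ?thesis using N(1,2) by blast
qed

lemma V_var_near_anisotropic_point:
  fixes A :: "'k::field ^ 'n ^ 'd"
  assumes A: "A \<in> V_var" and all: "ani_cols A = UNIV"
  shows "\<exists>N. openin zariski N \<and> A \<in> N \<and> V_var \<inter> N \<subseteq> stratum (rk_ani A) (rk_iso A)"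
proof -
  have "regular_at A (\<lambda>B. \<Prod>i\<in>UNIV. column i B \<cdot> column i B)"
    by (intro regular_at_prod regular_at_scalar_product regular_at_entry)
  moreover have "(\<Prod>i\<in>UNIV. column i A \<cdot> column i A) \<noteq> 0" using all by (auto simp: ani_cols_def)
  ultimately have "\<exists>N. openin zariski N \<and> A \<in> N \<and> (\<forall>B\<in>N. (\<Prod>i\<in>UNIV. column i B \<cdot> column i B) \<noteq> 0)"
    by (rule regular_at_nonzero_nbhd)
  then obtain N where N: "openin zariski N" "A \<in> N"
      "\<forall>B\<in>N. (\<Prod>i\<in>UNIV. column i B \<cdot> column i B) \<noteq> 0" by (elim exE conjE)
  have "B \<in> stratum (rk_ani A) (rk_iso A)" if "B \<in> V_var" "B \<in> N" for B
  proof -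
    have "ani_cols B = UNIV" using N(3) that(2) by (auto simp: ani_cols_def)
    then show ?thesis using all A that(1) by (simp add: stratum_def rk_ani_eq_card rk_iso_eq_dim)
  qed
  then show ?thesis using N(1,2) by blast
qed

section \<open>Strata with dense relative interior\<close>

definition stratum_interior :: "nat \<Rightarrow> nat \<Rightarrow> ('k::field ^ 'n ^ 'd) set" where
  "stratum_interior p q = {A \<in> stratum p q. \<exists>N. openin zariski N \<and> A \<in> N \<and> V_var \<inter> N \<subseteq> stratum p q}"

text \<open>Fix the anisotropic columns and those in \<open>J\<close>, and let the coordinates of the redundant columns vary on a
line. The stratum is not left. Since \<open>q \<le> s choose 2\<close>, the elements \<open>j\<close> of \<open>J\<close> can be assigned distinct
pairs \<open>\<pi> j\<close> of redundant columns; let the line reach at \<open>t = 1\<close> the incidence matrix of \<open>\<pi>\<close>. The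
coordinate vectors of the two columns in \<open>\<pi> j\<close> then have only the entry at \<open>j\<close> in common, so
\<open>V_var_near_generic_point\<close> applies at \<open>t = 1\<close>, and hence almost all points of the line are interior.\<close>
lemma stratum_interior_dense:
  fixes A :: "'k::field ^ 'n ^ 'd"
  assumes two: "(2::'k) \<noteq> 0" and inf: "infinite (UNIV :: 'k set)" and A: "A \<in> stratum p q"
    and good: "(p = CARD('n) \<and> q = 0) \<or> (p + 2 * q = CARD('d) \<and> q \<le> (CARD('n) - p - q) choose 2)"
  shows "A \<in> zariski closure_of (stratum_interior p q)"
proof -
  let ?I = "ani_cols A" and ?a = "\<lambda>j. column j A"
  have AV: "A \<in> V_var" and pq: "rk_ani A = p" "rk_iso A = q" using A by (auto simp: stratum_def)
  have p: "card ?I = p" using rk_ani_eq_card[OF AV] pq by simp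
  from good show ?thesis
  proof
    assume "p = CARD('n) \<and> q = 0"
    then have "?I = UNIV" using p by (intro card_eq_UNIV_imp_eq_UNIV) auto
    then have "A \<in> stratum_interior p q"
      using V_var_near_anisotropic_point[OF AV] A pq by (simp add: stratum_interior_def)
    then show ?thesis using closure_of_subset[of "stratum_interior p q" zariski] by (auto simp: topspace_zariski)
  next
    assume g: "p + 2 * q = CARD('d) \<and> q \<le> (CARD('n) - p - q) choose 2"
    obtain J w where F: "frame A J w" using ex_frame[OF two AV] by blast
    have q: "card J = q" using frame_rank(3)[OF F] pq by simp
    have IJ: "J \<inter> ?I = {}" using F unfolding frame_def by blast
    have ww: "w j \<cdot> w k = 0" if "j \<in> J" "k \<in> J" for j k using F that unfolding frame_def by blast
    have wa: "w j \<cdot> ?a h = (if h = j then 1 else 0)" if "j \<in> J" "h \<in> ?I \<union> J" for j h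
      using F that unfolding frame_def by blast
    have exA: "?a l = (\<Sum>j\<in>J. (w j \<cdot> ?a l) *s ?a j)" if "l \<notin> ?I" for l
      using F that unfolding frame_def by blast
    have aJ: "?a j \<cdot> ?a h = 0" if "j \<in> J" for j h
      using IJ that AV by (cases "j = h") (auto simp: V_var_iff ani_cols_def)
    let ?L = "- (?I \<union> J)"
    have "card (?I \<union> J) = p + q" using IJ p q by (subst card_Un_disjoint) auto
    then have "card ?L = CARD('n) - p - q" by (simp add: Compl_eq_Diff_UNIV card_Diff_subset)
    then have "card J \<le> card {B. B \<subseteq> ?L \<and> card B = 2}" using g q n_subsets[of ?L 2] by (simp only: finite)
    then obtain \<pi> where \<pi>: "\<pi> ` J \<subseteq> {B. B \<subseteq> ?L \<and> card B = 2}" "inj_on \<pi> J"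
      using card_le_inj[of J "{B. B \<subseteq> ?L \<and> card B = 2}"] by auto
    have "\<exists>x y. \<pi> j = {x, y} \<and> x \<noteq> y" if "j \<in> J" for j
      using \<pi>(1) that by (auto simp: card_2_iff)
    then obtain \<alpha> \<beta> where ab: "\<And>j. j \<in> J \<Longrightarrow> \<pi> j = {\<alpha> j, \<beta> j} \<and> \<alpha> j \<noteq> \<beta> j" by metis
    have \<pi>L: "\<pi> j \<subseteq> ?L" if "j \<in> J" for j using \<pi>(1) that by blast
    \<comment> \<open>\<open>c t l j\<close> is the coordinate at \<open>j\<close> of the redundant column \<open>l\<close> at the parameter \<open>t\<close>.\<close>
    define c where "c t l j = w j \<cdot> ?a l + t * ((if l \<in> \<pi> j then 1 else 0) - w j \<cdot> ?a l)" for t l j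
    define X where "X = of_columns (\<lambda>l. if l \<in> ?L then (\<Sum>j\<in>J. ((if l \<in> \<pi> j then 1 else 0) - w j \<cdot> ?a l) *s ?a j) else 0)"
    let ?B = "on_line A X"
    have colH: "column h (?B t) = ?a h" if "h \<in> ?I \<union> J" for h t
      using that by (auto simp: X_def column_on_line column_of_columns)
    have colL: "column l (?B t) = (\<Sum>j\<in>J. c t l j *s ?a j)" if "l \<in> ?L" for l t
    proof -
      have "column l (?B t) = (\<Sum>j\<in>J. (w j \<cdot> ?a l) *s ?a j) +
          t *s (\<Sum>j\<in>J. ((if l \<in> \<pi> j then 1 else 0) - w j \<cdot> ?a l) *s ?a j)"
        unfolding column_on_line X_def column_of_columns using exA[of l] that by simp
      also have "\<dots> = (\<Sum>j\<in>J. c t l j *s ?a j)"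
        unfolding vec.scale_sum_right sum.distrib[symmetric]
        by (intro sum.cong refl) (simp only: c_def vec.scale_left_distrib vec.scale_scale)
      finally show ?thesis .
    qed
    have sp: "column l (?B t) \<cdot> ?a h = 0" if "l \<in> ?L" for l h t
      using aJ unfolding colL[OF that] by (simp add: sp_simps)
    have spL: "column l (?B t) \<cdot> column m (?B t) = 0" if l: "l \<in> ?L" for l m t
    proof (cases "m \<in> ?L")
      case True
      show ?thesis unfolding colL[OF True] using sp[OF l] by (simp add: sp_simps)
    qed (use sp[OF l] colH in auto)
    have BV: "?B t \<in> V_var" for t
      unfolding V_var_iff
    proof (intro allI impI)
      fix i j :: 'n assume "i \<noteq> j"
      show "column i (?B t) \<cdot> column j (?B t) = 0"
      proof (cases "i \<in> ?L \<or> j \<in> ?L")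
        case True
        then show ?thesis using spL sp_commute[of "column i (?B t)"] by metis
      next
        case False
        then show ?thesis using AV \<open>i \<noteq> j\<close> colH by (simp add: V_var_iff)
      qed
    qed
    have ani: "ani_cols (?B t) = ?I" for t
    proof (intro equalityI subsetI)
      fix i assume "i \<in> ?I"
      then show "i \<in> ani_cols (?B t)" using colH[of i t] by (simp add: ani_cols_def)
    next
      fix i assume "i \<in> ani_cols (?B t)"
      then have "column i (?B t) \<cdot> column i (?B t) \<noteq> 0" by (simp add: ani_cols_def)
      then have "i \<notin> ?L" "i \<notin> J" using spL colH[of i t] aJ by auto
      then show "i \<in> ?I" by blast
    qed
    have wc: "w j \<cdot> column l (?B t) = c t l j" if "j \<in> J" "l \<in> ?L" for j l t
    proof -
      have "w j \<cdot> column l (?B t) = (\<Sum>i\<in>J. c t l i * (w j \<cdot> ?a i))"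
        unfolding colL[OF that(2)] by (simp add: sp_simps)
      also have "\<dots> = (\<Sum>i\<in>J. if i = j then c t l j else 0)"
        using that(1) by (intro sum.cong) (auto simp: wa)
      finally show ?thesis using that(1) by simp
    qed
    have FB: "frame (?B t) J w" for t
      unfolding frame_def ani
    proof (intro conjI ballI allI impI)
      show "w j \<cdot> column h (?B t) = (if h = j then 1 else 0)" if "j \<in> J" "h \<in> ?I \<union> J" for j h
        using wa[OF that] colH[OF that(2)] by simp
      show "column l (?B t) = (\<Sum>j\<in>J. (w j \<cdot> column l (?B t)) *s column j (?B t))" if "l \<notin> ?I" for l
      proof (cases "l \<in> J")
        case True
        have "(\<Sum>j\<in>J. (w j \<cdot> column l (?B t)) *s column j (?B t)) = (\<Sum>j\<in>J. if j = l then ?a l else 0)"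
          using True by (intro sum.cong) (auto simp: colH wa)
        then show ?thesis using True by (simp add: colH)
      next
        case False
        then have L: "l \<in> ?L" using that by blast
        have "(\<Sum>j\<in>J. (w j \<cdot> column l (?B t)) *s column j (?B t)) = (\<Sum>j\<in>J. c t l j *s ?a j)"
          by (intro sum.cong refl) (simp add: wc[OF _ L] colH)
        then show ?thesis using colL[OF L] by (simp only:)
      qed
    qed (use BV IJ ww in auto)
    have BS: "?B t \<in> stratum p q" for t
      using BV rk_ani_eq_card[OF BV] ani p frame_rank(3)[OF FB] q by (simp add: stratum_def)
    have "\<exists>N. openin zariski N \<and> ?B 1 \<in> N \<and> V_var \<inter> N \<subseteq> stratum (rk_ani (?B 1)) (rk_iso (?B 1))"
    proof (rule V_var_near_generic_point[OF two FB, where \<alpha> = \<alpha> and \<beta> = \<beta>])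
      show "card (ani_cols (?B 1)) + 2 * card J = CARD('d)" using ani p q g by simp
      show "\<alpha> j \<notin> ani_cols (?B 1) \<union> J" "\<beta> j \<notin> ani_cols (?B 1) \<union> J" "\<alpha> j \<noteq> \<beta> j" if "j \<in> J" for j
        using ab[OF that] \<pi>L[OF that] unfolding ani by auto
      show "(w i \<cdot> column (\<alpha> j) (?B 1)) * (w i \<cdot> column (\<beta> j) (?B 1)) = (if j = i then 1 else 0)"
        if "j \<in> J" "i \<in> J" for j i
      proof -
        have L: "\<alpha> j \<in> ?L" "\<beta> j \<in> ?L" using ab[OF that(1)] \<pi>L[OF that(1)] by auto
        have "\<pi> j = \<pi> i" if "\<alpha> j \<in> \<pi> i" "\<beta> j \<in> \<pi> i"
          using that ab[OF \<open>j \<in> J\<close>] ab[OF \<open>i \<in> J\<close>] by auto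
        then have "\<alpha> j \<in> \<pi> i \<and> \<beta> j \<in> \<pi> i \<longleftrightarrow> j = i"
          using ab[OF that(1)] \<pi>(2) that by (auto dest: inj_onD)
        then show ?thesis unfolding wc[OF that(2) L(1)] wc[OF that(2) L(2)] by (auto simp: c_def)
      qed
    qed
    then obtain N where N: "openin zariski N" "?B 1 \<in> N" "V_var \<inter> N \<subseteq> stratum p q"
      using BS[of 1] by (auto simp: stratum_def)
    have "{t. ?B t \<notin> stratum_interior p q} \<subseteq> {t. ?B t \<notin> N}"
      using BS N(1,3) by (auto simp: stratum_interior_def)
    then show ?thesis
      using line_meets_open_cofinitely[OF N(1,2)] inf finite_subset by (intro closure_of_along_line) blast+
  qed
qed

section \<open>The components of the variety\<close>

lemma real_choose_two: "real (m choose 2) = real m * (real m - 1) / 2"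
  by (induction m) (auto simp: numeral_2_eq_2 field_simps)

text \<open>In \<open>Omega\<close> either \<open>p + q = n\<close>, where \<open>sigma_fun\<close> exceeds the bound by \<open>- q\<close>, or \<open>p + 2q = d\<close>, where it
exceeds the bound by \<open>((n - p - q) choose 2) - q\<close>.\<close>
lemma numerical_condition_iff:
  assumes "p + q \<le> n" "p + 2 * q \<le> d"
  shows "(p, q) \<in> Omega d n \<and> sigma_fun d n p q \<ge> real n * real d - real (n choose 2) \<longleftrightarrow>
    (p = n \<and> q = 0) \<or> (p + 2 * q = d \<and> q \<le> (n - p - q) choose 2)"
proof -
  have Om: "(p, q) \<in> Omega d n \<longleftrightarrow> p + q = n \<or> p + 2 * q = d"
    using assms by (auto simp: Omega_def min_def)
  have A: "sigma_fun d n p q = real n * real d - real (n choose 2) - real q" if "p + q = n"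
    unfolding real_choose_two sigma_fun_def that[symmetric] by (simp add: field_simps power2_eq_square)
  have B: "sigma_fun d n p q = real n * real d - real (n choose 2) + real ((n - p - q) choose 2) - real q"
    if "p + 2 * q = d"
  proof -
    obtain s where s: "n = p + q + s" using assms(1) le_Suc_ex by blast
    show ?thesis
      unfolding real_choose_two sigma_fun_def that[symmetric] s by (simp add: field_simps power2_eq_square)
  qed
  show ?thesis
  proof (cases "p + 2 * q = d")
    case True
    then show ?thesis using Om B by auto
  next
    case False
    then show ?thesis using Om A by auto
  qed
qed

text \<open>By induction on the number of isotropic columns: unless \<open>A\<close> is in one of the listed strata, one of the
two deformations exhibits it as a limit of matrices with more anisotropic columns.\<close>
lemma V_var_subset_closure:
  assumes two: "(2::'k::field) \<noteq> 0" and inf: "infinite (UNIV :: 'k set)"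
  defines "U \<equiv> \<Union>{stratum p q :: ('k ^ 'n ^ 'd) set | p q.
    (p = CARD('n) \<and> q = 0) \<or> (p + 2 * q = CARD('d) \<and> p + q \<le> CARD('n) \<and> q \<le> (CARD('n) - p - q) choose 2)}"
  shows "V_var \<subseteq> zariski closure_of U"
proof
  fix A :: "'k ^ 'n ^ 'd" assume "A \<in> V_var"
  then show "A \<in> zariski closure_of U"
  proof (induction "CARD('n) - card (ani_cols A)" arbitrary: A rule: less_induct)
    case less
    let ?I = "ani_cols A"
    obtain J w where F: "frame A J w" using ex_frame[OF two less.prems] by blast
    have IJ: "?I \<inter> J = {}" using F unfolding frame_def by blast
    have le: "card ?I + 2 * card J \<le> CARD('d)" by (rule frame_card_le[OF F])
    have cIJ: "card (?I \<union> J) = card ?I + card J" using IJ by (intro card_Un_disjoint) auto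
    then have le': "card ?I + card J \<le> CARD('n)" using card_mono[of UNIV "?I \<union> J"] by simp
    have AS: "A \<in> stratum (card ?I) (card J)"
      using less.prems frame_rank(3)[OF F] rk_ani_eq_card[OF less.prems] by (simp add: stratum_def)
    show ?case
    proof (cases "(card ?I = CARD('n) \<and> card J = 0) \<or>
        (card ?I + 2 * card J = CARD('d) \<and> card J \<le> (CARD('n) - card ?I - card J) choose 2)")
      case True
      then have "A \<in> U" using AS le' unfolding U_def by blast
      then show ?thesis using closure_of_subset[of U zariski] by (auto simp: topspace_zariski)
    next
      case False
      have "\<exists>X. \<forall>t. t \<noteq> 0 \<longrightarrow> on_line A X t \<in> V_var \<and> ?I \<subset> ani_cols (on_line A X t)"
      proof (cases "card ?I + 2 * card J = CARD('d)")
        case True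
        then show ?thesis
          using False cIJ by (intro deform_by_dual_vectors[OF two F]) (simp add: Compl_eq_Diff_UNIV card_Diff_subset)
      next
        case less_d: False
        then have "\<exists>u. u \<cdot> u \<noteq> 0 \<and> (\<forall>i. u \<cdot> column i A = 0)"
          using le by (intro ex_anisotropic_orthogonal[OF two F]) simp
        moreover have "?I \<noteq> UNIV" using False le' by auto
        ultimately show ?thesis using deform_by_anisotropic_vector[OF less.prems] by blast
      qed
      then obtain X where X: "\<And>t. t \<noteq> 0 \<Longrightarrow> on_line A X t \<in> V_var \<and> ?I \<subset> ani_cols (on_line A X t)" by blast
      have "on_line A X t \<in> zariski closure_of U" if t: "t \<noteq> 0" for t
      proof (rule less.hyps)
        show "on_line A X t \<in> V_var" using X[OF t] by blast
        have "card ?I < card (ani_cols (on_line A X t))" using X[OF t] by (intro psubset_card_mono) auto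
        moreover have "card (ani_cols (on_line A X t)) \<le> CARD('n)" by (intro card_mono) auto
        ultimately show "CARD('n) - card (ani_cols (on_line A X t)) < CARD('n) - card ?I" by simp
      qed
      then have "{t. on_line A X t \<notin> zariski closure_of U} \<subseteq> {0}" by blast
      then have "A \<in> zariski closure_of (zariski closure_of U)"
        using finite_subset by (intro closure_of_along_line[OF inf]) blast
      then show ?thesis by simp
    qed
  qed
qed

theorem theorem5p8:
  fixes d n :: nat
  assumes "CHAR('k::alg_closed_field) \<noteq> 2"
    and "CARD('d::finite) = d" and "d \<ge> 1"
    and "CARD('n::finite) = n" and "n \<ge> 2"
  shows "irreducible_components (subtopology zariski (V_var :: ('k ^ 'n ^ 'd) set)) =
    {zariski closure_of C | C p q.
       (p, q) \<in> Omega d n \<and>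
       sigma_fun d n p q \<ge> real n * real d - real (n choose 2) \<and>
       C \<in> irreducible_components (subtopology zariski (stratum p q :: ('k ^ 'n ^ 'd) set))}"
proof -
  have two: "(2::'k) \<noteq> 0"
  proof
    assume "(2::'k) = 0"
    then have "CHAR('k) dvd 2" using of_nat_eq_0_iff_char_dvd[where ?'a = 'k, of 2] by simp
    then have "CHAR('k) \<le> 2" by (rule dvd_imp_le) simp
    moreover have "CHAR('k) \<noteq> 0"
    proof
      assume "CHAR('k) = 0"
      with \<open>CHAR('k) dvd 2\<close> show False by (metis dvd_0_left_iff zero_neq_numeral)
    qed
    moreover have "CHAR('k) \<noteq> 1"
    proof
      assume "CHAR('k) = 1"
      then show False using of_nat_CHAR[where ?'a = 'k] by simp
    qed
    ultimately show False using assms(1) by simp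
  qed
  note inf = infinite_UNIV_alg_closed[where ?'k = 'k]
  define good where "good p q \<longleftrightarrow> (p, q) \<in> Omega d n \<and>
     sigma_fun d n p q \<ge> real n * real d - real (n choose 2)" for p q
  let ?S = "\<lambda>p q. stratum p q :: ('k ^ 'n ^ 'd) set"
  let ?\<S> = "{?S p q | p q. good p q}"
  have good: "(p = n \<and> q = 0) \<or> (p + 2 * q = d \<and> q \<le> (n - p - q) choose 2)" if "good p q" for p q
  proof -
    have "p + q \<le> n" "p + 2 * q \<le> d" using that Omega_admissible unfolding good_def by blast+
    then show ?thesis using that numerical_condition_iff[of p q n d] unfolding good_def by simp
  qed
  have "irreducible_components (subtopology zariski (V_var :: ('k ^ 'n ^ 'd) set)) =
      {zariski closure_of C | C S. S \<in> ?\<S> \<and> C \<in> irreducible_components (subtopology zariski S)}"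
  proof (rule irreducible_components_eq_closures_of_strata[OF closedin_V_var])
    have "Omega d n \<subseteq> {..n} \<times> {..d}" by (auto simp: Omega_def)
    then have "finite (Omega d n)" by (rule finite_subset) simp
    moreover have "?\<S> \<subseteq> (\<lambda>(p, q). ?S p q) ` Omega d n" by (auto simp: good_def)
    ultimately show "finite ?\<S>" using finite_surj by blast
    show "S \<subseteq> V_var" if "S \<in> ?\<S>" for S using that by (auto simp: stratum_def)
    show "\<exists>\<E>. finite \<E> \<and> (\<forall>E\<in>\<E>. irreducible_in zariski E) \<and> S = \<Union>\<E>" for S :: "('k ^ 'n ^ 'd) set"
      by (rule finite_union_of_irreducible_sets)
    show "S \<subseteq> zariski closure_of {A \<in> S. \<exists>N. openin zariski N \<and> A \<in> N \<and> V_var \<inter> N \<subseteq> S}"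
      if S: "S \<in> ?\<S>" for S
    proof -
      obtain p q where pq: "S = ?S p q" "good p q" using S by blast
      then show ?thesis
        using stratum_interior_dense[OF two inf, of _ p q] good[OF pq(2)] assms(2,4)
        unfolding stratum_interior_def by auto
    qed
    have "\<Union>{?S p q | p q. (p = n \<and> q = 0) \<or> (p + 2 * q = d \<and> p + q \<le> n \<and> q \<le> (n - p - q) choose 2)} \<subseteq> \<Union>?\<S>"
    proof
      fix A assume "A \<in> \<Union>{?S p q | p q. (p = n \<and> q = 0) \<or> (p + 2 * q = d \<and> p + q \<le> n \<and> q \<le> (n - p - q) choose 2)}"
      then obtain p q where A: "A \<in> ?S p q"
          and h: "(p = n \<and> q = 0) \<or> (p + 2 * q = d \<and> p + q \<le> n \<and> q \<le> (n - p - q) choose 2)"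
        by blast
      have AV: "A \<in> V_var" using A by (simp add: stratum_def)
      obtain J w where F: "frame A J w" using ex_frame[OF two AV] by blast
      have "p + 2 * q \<le> d"
        using frame_card_le[OF F] frame_rank(3)[OF F] rk_ani_eq_card[OF AV] A assms(2) by (simp add: stratum_def)
      moreover have "p + q \<le> n" using h by auto
      ultimately have "good p q" using h numerical_condition_iff[of p q n d] unfolding good_def by blast
      then show "A \<in> \<Union>?\<S>" using A by blast
    qed
    then show "V_var \<subseteq> zariski closure_of (\<Union>?\<S>)"
      using V_var_subset_closure[OF two inf, where ?'n = 'n and ?'d = 'd] closure_of_mono
      unfolding assms(2,4) by blast
  qed
  also have "\<dots> = {zariski closure_of C | C p q. good p q \<and>
      C \<in> irreducible_components (subtopology zariski (?S p q))}"
    by auto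
  finally show ?thesis unfolding good_def by (simp only: conj_assoc)
qed

end
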